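(* Fix $d_1,d_2\in\mathbb{C}$, $n\in\mathbb{N}\cup\{0\}$ and $\alpha\in\mathbb{C}\setminus(2\mathbb{Z})$. The Toeplitz determinant $\Delta_n(x,\alpha)$ has the following asymptotics as $x\to0$, $-\pi<\arg(x)<\pi$. (1) If $d_2\neq0$ and, in addition, either $\mathrm{Re}(\alpha)>2n-2$ or $d_1\sin\left(\frac{\pi\alpha}{2}\right)+d_2\cos\left(\frac{\pi\alpha}{2}\right)=0$, then $$\Delta_n(x,\alpha)\sim(-1)^{\frac{n(n+1)}{2}}\left(\frac{d_2}{\pi}\right)^n\frac{G(n+1)G(\frac{\alpha}{2}+1)}{G(\frac{\alpha}{2}-n+1)}\left(\frac{x}{2}\right)^{-\frac{n\alpha}{2}}.$$ (2) If $d_2\neq0$, $d_1\sin\left(\frac{\pi\alpha}{2}\right)+d_2\cos\left(\frac{\pi\alpha}{2}\right)\neq0$, and $2n-4j-2<\mathrm{Re}(\alpha)<2n-4j+2$ for some $j\in\{1,2,\dots,n-1\}$, then $$\Delta_n(x,\alpha)\sim(-1)^{\frac{n(n+1)}{2}+j(n-1)}\left(\frac{d_2}{\pi}\right)^n\left(\frac{d_1}{d_2}\sin\left(\frac{\pi\alpha}{2}\right)+\cos\left(\frac{\pi\alpha}{2}\right)\right)^j\frac{G(n-j+1)G(-\frac{\alpha}{2}+n-j+1)G(j+1)G(j+\frac{\alpha}{2}+1)}{G(-\frac{\alpha}{2}+n-2j+1)G(\frac{\alpha}{2}-n+2j+1)}\left(\frac{x}{2}\right)^{(\alpha-2n+2j)j-\frac{n\alpha}{2}}.$$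 (3) If $d_1\sin\left(\frac{\pi\alpha}{2}\right)+d_2\cos\left(\frac{\pi\alpha}{2}\right)\neq0$ and, in addition, either $\mathrm{Re}(\alpha)<-2n+2$ or $d_2=0$, then $$\Delta_n(x,\alpha)\sim\frac{(-1)^{\frac{n(n+1)}{2}}}{\pi^n}\left(d_1\sin\left(\frac{\pi\alpha}{2}\right)+d_2\cos\left(\frac{\pi\alpha}{2}\right)\right)^n\frac{G(n+1)G(-\frac{\alpha}{2}+1)}{G(-\frac{\alpha}{2}-n+1)}\left(\frac{x}{2}\right)^{\frac{n\alpha}{2}}.$$
   Context: $J_\nu(x)$ and $Y_\nu(x)$ are the Bessel functions of the first and second kind (principal branches), and $\mathcal{C}_\nu(x)=d_1J_\nu(x)+d_2Y_\nu(x)$ with $d_1,d_2$ independent of $\nu$. For $n\in\mathbb{N}=\{1,2,\dots\}$, $\Delta_n(x,\alpha)=\det\left(\left\{\mathcal{C}_{\frac{\alpha}{2}-j+k}(x)\right\}_{j,k=0}^{n-1}\right)$, and $\Delta_0(x,\alpha)=1$. $G$ is the Barnes $G$-function. Powers of $x$ are principal branches. $f\sim g$ means $f=g\,(1+o(1))$. *)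

theory Defs
  imports
    "HOL-Analysis.Analysis"
    "HOL-Library.Landau_Symbols"
    "Jordan_Normal_Form.Determinant"
begin

text \<open>
  Bessel functions of complex order and complex argument, on the principal branch: the power
  is \<open>powr\<close>, with cut along the negative real axis. Since \<open>0 powr a = 0\<close>, the value at \<open>x = 0\<close>
  is meaningless for \<open>\<nu> = 0\<close>; only \<open>x \<noteq> 0\<close> matters.
\<close>

definition Bessel_J :: "complex \<Rightarrow> complex \<Rightarrow> complex" where
  "Bessel_J \<nu> x =
     (x / 2) powr \<nu> *
     (\<Sum>k. (-1) ^ k * rGamma (\<nu> + of_nat k + 1) / fact k * (x / 2) ^ (2 * k))"

definition Bessel_Y_quot :: "complex \<Rightarrow> complex \<Rightarrow> complex" where
  "Bessel_Y_quot \<nu> x =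
     (Bessel_J \<nu> x * cos (\<nu> * of_real pi) - Bessel_J (-\<nu>) x) / sin (\<nu> * of_real pi)"

definition Bessel_Y :: "complex \<Rightarrow> complex \<Rightarrow> complex" where
  "Bessel_Y \<nu> x =
     (if \<nu> \<in> \<int> then Lim (at \<nu>) (\<lambda>\<mu>. Bessel_Y_quot \<mu> x) else Bessel_Y_quot \<nu> x)"

definition cylinder_C :: "complex \<Rightarrow> complex \<Rightarrow> complex \<Rightarrow> complex \<Rightarrow> complex" where
  "cylinder_C d1 d2 \<nu> x = d1 * Bessel_J \<nu> x + d2 * Bessel_Y \<nu> x"

text \<open>The determinant of a \<open>0 \<times> 0\<close> matrix is \<open>1\<close>, in accordance with \<open>\<Delta>\<^sub>0 = 1\<close>.\<close>

definition Toeplitz_Delta :: "complex \<Rightarrow> complex \<Rightarrow> nat \<Rightarrow> complex \<Rightarrow> complex \<Rightarrow> complex" where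
  "Toeplitz_Delta d1 d2 n x \<alpha> =
     Determinant.det
       (Matrix.mat n n (\<lambda>(j, k). cylinder_C d1 d2 (\<alpha> / 2 - of_nat j + of_nat k) x))"

text \<open>
  The Barnes function by its Weierstrass product for \<open>G (1 + w)\<close> with \<open>w = z - 1\<close>. The product
  index is shifted: \<open>k\<close> here stands for the factor with index \<open>k + 1\<close>.
\<close>

definition Barnes_G :: "complex \<Rightarrow> complex" where
  "Barnes_G z =
     (let w = z - 1 in
        (2 * of_real pi) powr (w / 2) *
        exp (- (w + w ^ 2 * (1 + euler_mascheroni)) / 2) *
        (\<Prod>k. (1 + w / of_nat (Suc k)) ^ Suc k * exp (w ^ 2 / (2 * of_nat (Suc k)) - w)))"

lemma Toeplitz_Delta_0 [simp]: "Toeplitz_Delta d1 d2 0 x \<alpha> = 1"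
  by (simp add: Toeplitz_Delta_def)

end

(*
  For a = alpha/2 not an integer and y = x/2, each cylinder function of order a + m is
  A y^a y^m R(a+m, y) + B y^(-a) (-1)^m y^(-m) R(-a-m, y) with R(nu, y) -> 1/Gamma(nu+1) as y -> 0.
  Treating U = A y^a and V = B y^(-a) as independent variables, the determinant is a homogeneous
  polynomial sum_j F_j(y) U^j V^(n-j), and everything follows from
  F_j(y) y^(2j(n-j)) -> kappa_{n,j}(a), with kappa a quotient of Barnes functions.

  This limit follows by induction on n from the Desnanot-Jacobi identity
  D_{n+1}(a) D_{n-1}(a) = D_n(a)^2 - D_n(a+1) D_n(a-1). To see a single F_j, put U = w y^sigma, V = 1
  with sigma an odd integer: then one power of w dominates in every determinant occurring in the
  identity. For 0 < j < n+1 the square is negligible and the Barnes quotients match factor by factor;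
  for j = 0 and j = n+1 all three terms have the same order and G(z+1) = Gamma(z) G(z) is needed.
  Interpolation in w recovers the coefficients F_j, and in the theorem the condition on Re(alpha) says
  exactly that the term with index j dominates.
*)
theory Submission
  imports Defs "Jordan_Normal_Form.Char_Poly" "HOL-Real_Asymp.Real_Asymp"
begin

section \<open>Condensation of Toeplitz determinants\<close>

text \<open>Condensation yields a determinant only after division by the one two orders lower, so
  the induction has to carry nonzero leading coefficients along; they are nonzero for noninteger
  \<open>a\<close> and \<open>w \<noteq> 0\<close>. The full sum over powers of \<open>w\<close>
  cannot be followed at once, its terms having different orders in \<open>y\<close>. The orders for
  \<open>j\<close> and \<open>j + 1\<close> differ by \<open>\<sigma> - 2 n + 4 j + 2\<close>, which
  is odd together with \<open>\<sigma>\<close>, and condensation moves \<open>\<sigma>\<close> only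
  by 2; a unique dominant index therefore exists at every stage. Integer powers of \<open>y\<close>
  also keep these limits free of branches, which enter only at the very end.

  The Gamma shift of the Barnes function is derived from its Weierstrass product. Its constant
  \<open>sqrt (2 pi)\<close> is Stirling's: the product at \<open>w = 1\<close> shows that the
  Stirling quotient has a nonzero limit, and Wallis's product gives the value. The sine in kappa
  cancels the denominators \<open>sin (pi a)\<close> that \<open>A\<close> and \<open>B\<close>
  inherit from the definition of \<open>Y\<close>.\<close>

lemma det_two_column_identity:
  fixes u v :: "nat \<Rightarrow> 'a :: comm_ring_1"
  defines "B \<equiv> (\<lambda>n. Matrix.mat (n + 2) (n + 2) (\<lambda>(i, j). if j = 0 then u i else if j = n + 1 then v i
      else if i = j then 1 else 0))"
  shows "Determinant.det (B n) = u 0 * v (n + 1) - v 0 * u (n + 1)"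
proof -
  have B: "B n \<in> carrier_mat (n + 2) (n + 2)" by (simp add: B_def)
  have diag: "B n $$ (Suc i, Suc i) = (if i = n then v (n + 1) else 1)" if "i \<le> n" for i
    using that by (simp add: B_def)
  have corner: "Determinant.det (mat_delete (B n) 0 0) = v (n + 1)"
  proof -
    have "Determinant.det (mat_delete (B n) 0 0) = prod_list (diag_mat (mat_delete (B n) 0 0))"
      by (rule det_upper_triangular[of _ "n + 1"])
         (auto simp: B_def mat_delete_def upper_triangular_def)
    also have "diag_mat (mat_delete (B n) 0 0) = replicate n 1 @ [v (n + 1)]"
      by (rule nth_equalityI) (use B in \<open>auto simp: mat_delete_def diag_mat_def nth_append diag\<close>)
    finally show ?thesis by simp
  qed
  \<comment> \<open>Only the two corner entries of the first row of \<open>B n\<close> can be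
    nonzero. In the minor of the right corner, the last row keeps only \<open>u (n + 1)\<close>,
    whose own minor is an identity matrix.\<close>
  define C where "C = mat_delete (B n) 0 (n + 1)"
  have C: "C \<in> carrier_mat (n + 1) (n + 1)" by (simp add: C_def B_def mat_delete_def)
  have last: "mat_delete C n 0 = 1\<^sub>m n"
    by (rule eq_matI) (auto simp: C_def B_def mat_delete_def)
  have row: "C $$ (n, k) = (if k = 0 then u (n + 1) else 0)" if "k < n + 1" for k
    using that by (auto simp: C_def B_def mat_delete_def)
  have "Determinant.det C = (\<Sum>k<n + 1. C $$ (n, k) * cofactor C n k)"
    by (rule laplace_expansion_row[OF C]) simp
  also have "\<dots> = (\<Sum>k<n + 1. if k = 0 then u (n + 1) * cofactor C n 0 else 0)"
    by (intro sum.cong refl) (simp add: row)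
  also have "\<dots> = u (n + 1) * (-1) ^ n"
    by (simp add: cofactor_def last del: sum.lessThan_Suc)
  finally have detC: "Determinant.det C = u (n + 1) * (-1) ^ n" .
  have "Determinant.det (B n) = (\<Sum>k<n + 2. B n $$ (0, k) * cofactor (B n) 0 k)"
    by (rule laplace_expansion_row[OF B]) simp
  also have "\<dots> = (\<Sum>k\<in>{0, n + 1}. B n $$ (0, k) * cofactor (B n) 0 k)"
    by (rule sum.mono_neutral_right) (auto simp: B_def)
  also have "\<dots> = u 0 * v (n + 1) - v 0 * u (n + 1)"
    by (simp add: cofactor_def corner detC[unfolded C_def, simplified] mult.left_commute flip: power_add)
       (simp add: B_def minus_one_power_iff)
  finally show ?thesis .
qed

text \<open>Jacobi's argument: \<open>B\<close> is the identity with its first and last columns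
  replaced by those of the adjugate of \<open>M\<close>. Then \<open>M * B\<close> is
  \<open>M\<close> with these columns replaced by \<open>d\<close> times unit vectors, so its
  determinant is \<open>d^2\<close> times the inner minor, while \<open>det B\<close> is a 2 x 2
  determinant of cofactors. One factor \<open>d\<close> is cancelled, hence the assumption on
  \<open>det M\<close>.\<close>

lemma desnanot_jacobi_aux:
  fixes M :: "'a :: idom mat"
  assumes M: "M \<in> carrier_mat (n + 2) (n + 2)" and nz: "Determinant.det M \<noteq> 0"
  shows "Determinant.det M * Determinant.det (mat_delete (mat_delete M 0 0) n n) =
    Determinant.det (mat_delete M 0 0) * Determinant.det (mat_delete M (n + 1) (n + 1)) -
    Determinant.det (mat_delete M 0 (n + 1)) * Determinant.det (mat_delete M (n + 1) 0)"
proof -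
  define u where "u = (\<lambda>i. cofactor M 0 i)"
  define v where "v = (\<lambda>i. cofactor M (n + 1) i)"
  define B where "B = Matrix.mat (n + 2) (n + 2) (\<lambda>(i, j). if j = 0 then u i else if j = n + 1 then v i
      else if i = j then 1 else (0 :: 'a))"
  define d where "d = Determinant.det M"
  have B: "B \<in> carrier_mat (n + 2) (n + 2)" by (simp add: B_def)
  have adj: "M * adj_mat M = d \<cdot>\<^sub>m 1\<^sub>m (n + 2)" using adj_mat(2)[OF M] by (simp add: d_def)
  have ent: "(\<Sum>k<n + 2. M $$ (i, k) * cofactor M j k) = (if i = j then d else 0)"
    if "i < n + 2" "j < n + 2" for i j
  proof -
    have "(M * adj_mat M) $$ (i, j) = (\<Sum>k<n + 2. M $$ (i, k) * cofactor M j k)"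
      using that M adj_mat(1)[OF M]
      by (auto simp: scalar_prod_def adj_mat_def lessThan_atLeast0 intro!: sum.cong)
    thus ?thesis using that by (cases "i = j") (simp_all add: adj del: sum.lessThan_Suc add_2_eq_Suc add_2_eq_Suc')
  qed
  have MB: "M * B = Matrix.mat (n + 2) (n + 2) (\<lambda>(i, j). if j = 0 then (if i = 0 then d else 0)
      else if j = n + 1 then (if i = n + 1 then d else 0) else M $$ (i, j))" (is "_ = ?D")
  proof (rule eq_matI)
    fix i j assume "i < dim_row ?D" "j < dim_col ?D"
    hence ij: "i < n + 2" "j < n + 2" by auto
    have "(M * B) $$ (i, j) = (\<Sum>k<n + 2. M $$ (i, k) * B $$ (k, j))"
      using ij M B by (auto simp: scalar_prod_def lessThan_atLeast0 intro!: sum.cong)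
    also have "\<dots> = ?D $$ (i, j)"
    proof -
      consider "j = 0" | "j = n + 1" | "j \<noteq> 0" "j \<noteq> n + 1" by blast
      thus ?thesis
      proof cases
        case 1
        thus ?thesis using ent[OF ij(1), of 0] ij by (simp add: B_def u_def)
      next
        case 2
        thus ?thesis using ent[OF ij(1), of "n + 1"] ij by (simp add: B_def v_def)
      next
        case 3
        have "(\<Sum>k<n + 2. M $$ (i, k) * B $$ (k, j)) = (\<Sum>k<n + 2. if k = j then M $$ (i, j) else 0)"
          by (rule sum.cong) (use 3 ij in \<open>auto simp: B_def\<close>)
        thus ?thesis using 3 ij by simp
      qed
    qed
    finally show "(M * B) $$ (i, j) = ?D $$ (i, j)" .
  qed (use M B in auto)
  define D where "D = ?D"
  have D: "D \<in> carrier_mat (n + 2) (n + 2)" by (simp add: D_def)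
  define D' where "D' = mat_delete D 0 0"
  have D': "D' \<in> carrier_mat (n + 1) (n + 1)" by (simp add: D'_def D_def mat_delete_def)
  have "Determinant.det D = (\<Sum>k<n + 2. D $$ (k, 0) * cofactor D k 0)"
    by (rule laplace_expansion_column[OF D]) simp
  also have "\<dots> = (\<Sum>k<n + 2. if k = 0 then d * cofactor D 0 0 else 0)"
    by (intro sum.cong refl) (auto simp: D_def)
  also have "\<dots> = d * Determinant.det D'"
    by (simp add: cofactor_def D'_def)
  also have "Determinant.det D' = (\<Sum>k<n + 1. D' $$ (k, n) * cofactor D' k n)"
    by (rule laplace_expansion_column[OF D']) simp
  also have "\<dots> = (\<Sum>k<n + 1. if k = n then d * cofactor D' n n else 0)"
    by (intro sum.cong refl) (auto simp: D'_def D_def mat_delete_def)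
  also have "\<dots> = d * Determinant.det (mat_delete D' n n)"
    by (simp add: cofactor_def flip: power_add)
  also have "mat_delete D' n n = mat_delete (mat_delete M 0 0) n n"
    by (rule eq_matI) (use M in \<open>auto simp: D'_def D_def mat_delete_def\<close>)
  finally have "Determinant.det (M * B) = d * (d * Determinant.det (mat_delete (mat_delete M 0 0) n n))"
    by (simp add: MB D_def)
  moreover have "Determinant.det (M * B) = d * Determinant.det B"
    using det_mult[OF M B] by (simp add: d_def)
  moreover have "Determinant.det B = u 0 * v (n + 1) - v 0 * u (n + 1)"
    unfolding B_def by (rule det_two_column_identity)
  ultimately have "d * Determinant.det (mat_delete (mat_delete M 0 0) n n) = u 0 * v (n + 1) - v 0 * u (n + 1)"
    using nz by (simp add: d_def)
  \<comment> \<open>The cofactors at the two off-diagonal corners carry the same sign, which cancels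
    in their product.\<close>
  thus ?thesis
    by (simp add: d_def u_def v_def cofactor_def mult_ac flip: power_add power_Suc)
qed

text \<open>With the symbol indexed by integers, the minors at opposite corners are determinants of
  the same kind with the symbol shifted by one. A general ring is used because polynomial entries
  occur later.\<close>

definition toeplitz_det :: "nat \<Rightarrow> (int \<Rightarrow> 'a :: comm_ring_1) \<Rightarrow> 'a" where
  "toeplitz_det n e = Determinant.det (Matrix.mat n n (\<lambda>(j, k). e (int k - int j)))"

context comm_ring_hom
begin

lemma hom_toeplitz_det: "hom (toeplitz_det n e) = toeplitz_det n (\<lambda>m. hom (e m))"
proof -
  have "map_mat hom (Matrix.mat n n (\<lambda>(j, k). e (int k - int j))) =
      Matrix.mat n n (\<lambda>(j, k). hom (e (int k - int j)))"
    by (rule eq_matI) auto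
  thus ?thesis unfolding toeplitz_det_def by (metis hom_det)
qed

end

lemma toeplitz_det_condensation_aux:
  fixes e :: "int \<Rightarrow> 'a :: idom"
  assumes nz: "toeplitz_det (n + 2) e \<noteq> 0"
  shows "toeplitz_det (n + 2) e * toeplitz_det n e =
    toeplitz_det (n + 1) e ^ 2 -
    toeplitz_det (n + 1) (\<lambda>m. e (m + 1)) * toeplitz_det (n + 1) (\<lambda>m. e (m - 1))"
proof -
  define M where "M = Matrix.mat (n + 2) (n + 2) (\<lambda>(j, k). e (int k - int j))"
  have M: "M \<in> carrier_mat (n + 2) (n + 2)" by (simp add: M_def)
  have minors: "mat_delete M 0 0 = Matrix.mat (n + 1) (n + 1) (\<lambda>(j, k). e (int k - int j))"
    "mat_delete M (n + 1) (n + 1) = Matrix.mat (n + 1) (n + 1) (\<lambda>(j, k). e (int k - int j))"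
    "mat_delete M 0 (n + 1) = Matrix.mat (n + 1) (n + 1) (\<lambda>(j, k). e (int k - int j - 1))"
    "mat_delete M (n + 1) 0 = Matrix.mat (n + 1) (n + 1) (\<lambda>(j, k). e (int k - int j + 1))"
    by (rule eq_matI; force simp: M_def mat_delete_def algebra_simps)+
  have inner: "mat_delete (mat_delete M 0 0) n n = Matrix.mat n n (\<lambda>(j, k). e (int k - int j))"
    by (rule eq_matI) (auto simp: M_def mat_delete_def)
  have "Determinant.det M \<noteq> 0" using nz by (simp add: toeplitz_det_def M_def)
  from desnanot_jacobi_aux[OF M this] show ?thesis
    unfolding inner unfolding minors unfolding M_def by (simp add: toeplitz_det_def power2_eq_square mult_ac)
qed

text \<open>The nonvanishing assumption is removed by adding an indeterminate to the diagonal: the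
  determinant becomes a characteristic polynomial, which is monic, and evaluation at 0 returns to
  the given symbol.\<close>

theorem toeplitz_det_condensation:
  fixes e :: "int \<Rightarrow> 'a :: idom"
  shows "toeplitz_det (n + 2) e * toeplitz_det n e =
    toeplitz_det (n + 1) e ^ 2 -
    toeplitz_det (n + 1) (\<lambda>m. e (m + 1)) * toeplitz_det (n + 1) (\<lambda>m. e (m - 1))"
proof -
  have ev: "comm_ring_hom (\<lambda>p :: 'a poly. poly p 0)"
    by unfold_locales auto
  define E where "E = (\<lambda>m. [:e m, if m = 0 then 1 else 0:])"
  \<comment> \<open>A characteristic polynomial is \<open>det (X I - A)\<close>; negating the
    entries of \<open>A\<close> gives \<open>+ e\<close>.\<close>
  have "Matrix.mat (n + 2) (n + 2) (\<lambda>(j, k). E (int k - int j)) =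
      char_poly_matrix (Matrix.mat (n + 2) (n + 2) (\<lambda>(j, k). - e (int k - int j)))"
    by (rule eq_matI) (auto simp: E_def char_poly_matrix_def)
  hence "toeplitz_det (n + 2) E = char_poly (Matrix.mat (n + 2) (n + 2) (\<lambda>(j, k). - e (int k - int j)))"
    by (simp add: toeplitz_det_def char_poly_def)
  moreover have "monic (char_poly (Matrix.mat (n + 2) (n + 2) (\<lambda>(j, k). - e (int k - int j))))"
    using degree_monic_char_poly[of "Matrix.mat (n + 2) (n + 2) (\<lambda>(j, k). - e (int k - int j))" "n + 2"] by simp
  ultimately have "toeplitz_det (n + 2) E \<noteq> 0" by auto
  from arg_cong[OF toeplitz_det_condensation_aux[OF this], of "\<lambda>p. poly p 0"]
  show ?thesis by (simp add: comm_ring_hom.hom_toeplitz_det[OF ev] E_def)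
qed

section \<open>The Barnes function\<close>

text \<open>The first two terms of the logarithm cancel in \<open>Barnes_factor\<close>, so the
  cubic remainder decides the convergence of the product. The tail of the series is compared with a
  geometric one.\<close>

lemma Ln_approx_quadratic:
  fixes z :: complex
  assumes "norm z \<le> 1 / 2"
  shows "norm (Ln (1 + z) - z + z ^ 2 / 2) \<le> 2 * norm z ^ 3"
proof -
  have lt: "norm z < 1" using assms by simp
  define f where "f = (\<lambda>n. - ((-z) ^ n) / of_nat n)"
  have "(\<lambda>i. f (i + 3)) sums (Ln (1 + z) - (\<Sum>i<3. f i))"
    by (rule sums_split_initial_segment) (use Ln_series'[OF lt] in \<open>simp add: f_def\<close>)
  \<comment> \<open>\<open>f 0 = 0\<close>, as division by zero gives 0.\<close>
  also have "(\<Sum>i<3. f i) = z - z ^ 2 / 2" by (simp add: f_def eval_nat_numeral)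
  finally have s: "(\<lambda>i. f (i + 3)) sums (Ln (1 + z) - z + z ^ 2 / 2)"
    by (simp add: algebra_simps)
  have g: "(\<lambda>i. norm z ^ 3 * norm z ^ i) sums (norm z ^ 3 * (1 / (1 - norm z)))"
    by (intro sums_mult geometric_sums) (use lt in simp)
  have "norm (f (i + 3)) \<le> norm z ^ 3 * norm z ^ i" for i
  proof -
    have "norm (f (i + 3)) = norm z ^ (i + 3) / real (i + 3)"
      by (simp add: f_def norm_divide norm_power del: of_nat_add)
    also have "\<dots> \<le> norm z ^ (i + 3) / 1"
      by (rule divide_left_mono) auto
    finally show ?thesis by (simp add: power_add mult.commute)
  qed
  hence "norm (Ln (1 + z) - z + z ^ 2 / 2) \<le> norm z ^ 3 * (1 / (1 - norm z))"
    by (rule norm_sums_le[OF s g])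
  also have "\<dots> \<le> norm z ^ 3 * 2"
    by (rule mult_left_mono) (use assms in \<open>auto simp: field_simps\<close>)
  finally show ?thesis by (simp add: mult.commute)
qed

lemma tendsto_exp_limit_complex:
  fixes z :: complex
  shows "(\<lambda>n. (1 + z / of_nat n) ^ n) \<longlonglongrightarrow> exp z"
proof -
  have ev: "\<forall>\<^sub>F n in sequentially. real n > 2 * norm z"
    using filterlim_real_sequentially by (simp add: filterlim_at_top_dense)
  have "(\<lambda>n. of_nat n * Ln (1 + z / of_nat n) - z) \<longlonglongrightarrow> 0"
  proof (rule Lim_null_comparison)
    show "\<forall>\<^sub>F n in sequentially. norm (of_nat n * Ln (1 + z / of_nat n) - z) \<le> 2 * norm z ^ 2 / real n"
      using ev
    proof eventually_elim
      case (elim n)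
      have n: "real n > 0" using elim norm_ge_zero[of z] by linarith
      define h where "h = z / of_nat n"
      have h: "norm h \<le> 1 / 2" using elim n by (simp add: h_def norm_divide field_simps)
      have "of_nat n * Ln (1 + h) - z = of_nat n * (Ln (1 + h) - h)"
        using n by (simp add: h_def right_diff_distrib)
      hence "norm (of_nat n * Ln (1 + h) - z) = real n * norm (Ln (1 + h) - h)"
        by (simp add: norm_mult)
      also have "\<dots> \<le> real n * (norm h ^ 2 / (1 - norm h))"
        using h by (intro mult_left_mono Ln_approx_linear) auto
      also have "\<dots> \<le> real n * (norm h ^ 2 / (1 / 2))"
        using h by (intro mult_left_mono divide_left_mono) auto
      also have "\<dots> = 2 * norm z ^ 2 / real n"
        using n by (simp add: h_def norm_divide field_simps power2_eq_square)
      finally show ?case by (simp add: h_def)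
    qed
    show "(\<lambda>n. 2 * norm z ^ 2 / real n) \<longlonglongrightarrow> 0" by (rule lim_const_over_n)
  qed
  hence "(\<lambda>n. exp (of_nat n * Ln (1 + z / of_nat n))) \<longlonglongrightarrow> exp z"
    by (intro tendsto_exp) (simp add: LIM_zero_iff)
  moreover have "\<forall>\<^sub>F n in sequentially. exp (of_nat n * Ln (1 + z / of_nat n)) = (1 + z / of_nat n) ^ n"
    using ev
  proof eventually_elim
    case (elim n)
    have "1 + z / of_nat n \<noteq> 0"
    proof
      assume "1 + z / of_nat n = 0"
      hence "norm (z / of_nat n) = 1" by (metis add_eq_0_iff norm_minus_cancel norm_one)
      thus False using elim by (auto simp: norm_divide field_simps split: if_splits)
    qed
    thus ?case by (simp add: exp_of_nat_mult)
  qed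
  ultimately show ?thesis by (rule Lim_transform_eventually)
qed

section \<open>Convergence and zeros of the Weierstrass product\<close>

definition Barnes_factor :: "complex \<Rightarrow> nat \<Rightarrow> complex" where
  "Barnes_factor w k = (1 + w / of_nat (Suc k)) ^ Suc k * exp (w ^ 2 / (2 * of_nat (Suc k)) - w)"

lemma Barnes_G_1_plus:
  "Barnes_G (1 + w) = (2 * of_real pi) powr (w / 2) * exp (- (w + w ^ 2 * (1 + euler_mascheroni)) / 2) *
     prodinf (Barnes_factor w)"
  by (simp add: Barnes_G_def Barnes_factor_def[abs_def])

text \<open>A factor with large index \<open>N\<close> is the exponential of
  \<open>N (Ln (1 + w / N) - w / N + (w / N)^2 / 2)\<close>, which is bounded by a multiple of
  \<open>1 / N^2\<close>. The finitely many initial factors, where zeros may occur, are split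
  off.\<close>

lemma convergent_prod_Barnes_factor: "convergent_prod (Barnes_factor w)"
proof -
  obtain M :: nat where M: "real M > 2 * norm w" using reals_Archimedean2 by blast
  define N where "N = (\<lambda>k. of_nat (Suc (k + M)) :: complex)"
  define g where "g = (\<lambda>k. N k * (Ln (1 + w / N k) - w / N k + (w / N k) ^ 2 / 2))"
  have [simp]: "N k \<noteq> 0" for k unfolding N_def by (rule of_nat_neq_0)
  have small: "norm (w / N k) \<le> 1 / 2" for k
  proof -
    have "2 * norm w \<le> real (Suc (k + M))" using M by simp
    thus ?thesis by (simp add: N_def norm_divide field_simps del: of_nat_Suc)
  qed
  have nz: "1 + w / N k \<noteq> 0" for k
  proof
    assume "1 + w / N k = 0"
    hence "w / N k = -1" by (metis add_eq_0_iff)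
    with small[of k] show False by simp
  qed
  have eq: "Barnes_factor w (k + M) = exp (g k)" for k
  proof -
    have Nk: "of_nat (Suc (k + M)) = N k" by (simp add: N_def)
    have "exp (g k) = exp (of_nat (Suc (k + M)) * Ln (1 + w / N k)) * exp (w ^ 2 / (2 * N k) - w)"
      unfolding Nk mult_exp_exp
      by (simp add: g_def algebra_simps power2_eq_square)
    also have "exp (of_nat (Suc (k + M)) * Ln (1 + w / N k)) = (1 + w / N k) ^ Suc (k + M)"
      by (subst exp_of_nat_mult) (use nz in \<open>simp add: exp_Ln\<close>)
    finally show ?thesis by (simp add: Barnes_factor_def N_def)
  qed
  have bound: "norm (g k) \<le> 2 * norm w ^ 3 * (1 / real (Suc (k + M)) ^ 2)" for k
  proof -
    have "norm (g k) \<le> real (Suc (k + M)) * (2 * norm (w / N k) ^ 3)"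
      unfolding g_def norm_mult
      by (rule mult_mono) (use Ln_approx_quadratic[OF small] in \<open>auto simp: N_def simp del: of_nat_Suc\<close>)
    also have "\<dots> = 2 * norm w ^ 3 * (1 / real (Suc (k + M)) ^ 2)"
      by (simp add: N_def norm_divide power_divide power2_eq_square power3_eq_cube del: of_nat_Suc)
    finally show ?thesis .
  qed
  have "summable (\<lambda>k. 1 / real k ^ 2)"
    using inverse_power_summable[of 2, where ?'a = real] by (simp add: field_simps)
  hence "summable (\<lambda>k. 1 / real (k + Suc M) ^ 2)" by (rule summable_ignore_initial_segment)
  hence "summable (\<lambda>k. 2 * norm w ^ 3 * (1 / real (Suc (k + M)) ^ 2))"
    by (intro summable_mult) simp
  hence "summable g"
    by (rule summable_comparison_test'[where N = 0]) (use bound in auto)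
  hence "convergent_prod (\<lambda>k. Barnes_factor w (k + M))"
    unfolding eq by (rule convergent_prod_exp)
  thus ?thesis by (rule convergent_prod_offset)
qed

lemma Barnes_partial_LIMSEQ: "(\<lambda>n. \<Prod>k<n. Barnes_factor w k) \<longlonglongrightarrow> prodinf (Barnes_factor w)"
  using convergent_prod_LIMSEQ[OF convergent_prod_Barnes_factor, of w]
  by (subst filterlim_sequentially_Suc[symmetric]) (simp add: lessThan_Suc_atMost)

text \<open>The factor with index \<open>k\<close> vanishes only at \<open>z = - k\<close>, and a
  convergent product without zero factors is nonzero.\<close>

lemma Barnes_G_nonzero:
  assumes "z \<notin> \<int>\<^sub>\<le>\<^sub>0"
  shows "Barnes_G z \<noteq> 0"
proof -
  have "Barnes_factor (z - 1) k \<noteq> 0" for k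
  proof
    assume "Barnes_factor (z - 1) k = 0"
    hence "1 + (z - 1) / of_nat (Suc k) = 0" by (auto simp: Barnes_factor_def simp del: of_nat_Suc)
    hence "z = - of_nat k" by (simp add: field_simps del: of_nat_Suc) (simp add: algebra_simps eq_neg_iff_add_eq_0)
    with assms show False by auto
  qed
  from prodinf_nonzero[OF convergent_prod_Barnes_factor this]
  show ?thesis using Barnes_G_1_plus[of "z - 1"] by simp
qed

section \<open>The functional equation and Stirling's constant\<close>

lemma Barnes_G_1 [simp]: "Barnes_G 1 = 1"
  using Barnes_G_1_plus[of 0] by (simp add: Barnes_factor_def[abs_def])

text \<open>A finite form of the functional equation. The powers telescope up to one factor per
  index, collected by \<open>pochhammer\<close>; the exponents add up to harmonic numbers through
  \<open>((w + 1)^2 - w^2) / (2 N) - 1 = (w + 1 / 2) / N - 1\<close>.\<close>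

lemma Barnes_partial_shift:
  "(\<Prod>k<n. Barnes_factor (w + 1) k) * pochhammer (w + 1) n =
     (\<Prod>k<n. Barnes_factor w k) * (of_nat n + 1 + w) ^ n * exp ((w + 1 / 2) * harm n - of_nat n)"
proof (induction n)
  case (Suc n)
  define N where "N = (of_nat (Suc n) :: complex)"
  have [simp]: "N \<noteq> 0" unfolding N_def by (rule of_nat_neq_0)
  have w1: "1 + (w + 1) / N = (N + 1 + w) / N" and w0: "1 + w / N = (of_nat n + 1 + w) / N"
    by (simp_all add: field_simps) (simp add: N_def)
  have bf1: "Barnes_factor (w + 1) n = ((N + 1 + w) / N) ^ Suc n * exp ((w + 1) ^ 2 / (2 * N) - (w + 1))"
    unfolding Barnes_factor_def N_def[symmetric] w1 ..
  have e: "exp ((w + 1) ^ 2 / (2 * N) - (w + 1)) * exp ((w + 1 / 2) * harm n - of_nat n) =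
      exp (w ^ 2 / (2 * N) - w) * exp ((w + 1 / 2) * harm (Suc n) - N)"
  proof -
    have n: "of_nat n = N - 1" by (simp add: N_def)
    have "(w + 1) ^ 2 / (2 * N) - (w + 1) + ((w + 1 / 2) * harm n - of_nat n) =
        w ^ 2 / (2 * N) - w + ((w + 1 / 2) * (harm n + 1 / N) - N)"
      unfolding n by (simp add: divide_simps) (simp add: algebra_simps power2_eq_square)
    from arg_cong[OF this, of exp] show ?thesis
      unfolding mult_exp_exp harm_Suc inverse_eq_divide N_def[symmetric] .
  qed
  have "(\<Prod>k<Suc n. Barnes_factor (w + 1) k) * pochhammer (w + 1) (Suc n) =
      ((\<Prod>k<n. Barnes_factor (w + 1) k) * pochhammer (w + 1) n) * Barnes_factor (w + 1) n * (of_nat n + 1 + w)"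
    by (simp add: pochhammer_Suc algebra_simps)
  also have "\<dots> = (\<Prod>k<n. Barnes_factor w k) * (of_nat n + 1 + w) ^ Suc n * ((N + 1 + w) / N) ^ Suc n *
      (exp ((w + 1) ^ 2 / (2 * N) - (w + 1)) * exp ((w + 1 / 2) * harm n - of_nat n))"
    unfolding Suc bf1 by simp
  also have "\<dots> = (\<Prod>k<n. Barnes_factor w k) * (((of_nat n + 1 + w) / N) ^ Suc n * exp (w ^ 2 / (2 * N) - w)) *
      (N + 1 + w) ^ Suc n * exp ((w + 1 / 2) * harm (Suc n) - N)"
    unfolding e power_divide by (simp only: times_divide_eq_left times_divide_eq_right mult_ac)
  also have "((of_nat n + 1 + w) / N) ^ Suc n * exp (w ^ 2 / (2 * N) - w) = Barnes_factor w n"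
    unfolding Barnes_factor_def N_def[symmetric] w0 by simp
  finally show ?case by (simp add: N_def mult_ac)
qed (simp add: harm_def)

text \<open>The inverse of the quotient in Stirling's formula. It is what remains of the factorial
  in the finite functional equation once the other powers of \<open>n\<close> are absorbed.\<close>

definition Stirling_ratio :: "nat \<Rightarrow> real" where
  "Stirling_ratio n = real n ^ n * sqrt (real n) * exp (- real n) / fact n"

text \<open>The finite functional equation regrouped so that each factor converges: the power
  \<open>n^(w + 1)\<close> in \<open>rGamma_series\<close> turns the harmonic number into
  \<open>harm n - ln n\<close>, and the leftovers form \<open>Stirling_ratio\<close>.\<close>

lemma Barnes_partial_rGamma:
  assumes "n > 0"
  shows "(\<Prod>k<n. Barnes_factor (w + 1) k) * rGamma_series (w + 1) n =
     (\<Prod>k<n. Barnes_factor w k) *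
     ((1 + (w + 1) / of_nat n) ^ n * (1 + (w + 1) / of_nat n) *
      exp ((w + 1 / 2) * of_real (harm n - ln (of_nat n))) * of_real (Stirling_ratio n))"
proof -
  define N where "N = (of_nat n :: complex)"
  have [simp]: "N \<noteq> 0" using assms by (simp add: N_def)
  define l where "l = complex_of_real (ln (real n))"
  have l: "exp l = N" using assms by (simp add: l_def N_def exp_of_real)
  have "sqrt (real n) = exp (ln (real n) / 2)"
    using assms by (simp add: ln_sqrt[symmetric] exp_ln)
  hence sq: "complex_of_real (sqrt (real n)) = exp (l / 2)"
    by (simp add: l_def exp_of_real[symmetric])
  have "(\<Prod>k<n. Barnes_factor (w + 1) k) * rGamma_series (w + 1) n =
    (\<Prod>k<n. Barnes_factor (w + 1) k) * pochhammer (w + 1) n * (N + 1 + w) / (fact n * exp ((w + 1) * l))"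
    by (simp add: rGamma_series_def pochhammer_Suc l_def N_def add_ac mult_ac)
  also have "\<dots> = (\<Prod>k<n. Barnes_factor w k) * (N + 1 + w) ^ n * (N + 1 + w) *
      (exp ((w + 1 / 2) * harm n - N) / exp ((w + 1) * l)) / fact n"
    unfolding Barnes_partial_shift by (simp add: N_def) (simp only: mult_ac)
  also have "exp ((w + 1 / 2) * harm n - N) / exp ((w + 1) * l) =
      exp ((w + 1 / 2) * (harm n - l)) * exp (- N) * exp (l / 2) / N"
    unfolding l[symmetric] exp_diff[symmetric] mult_exp_exp
    by (rule arg_cong[where f = exp]) (simp add: field_simps)
  also have "(\<Prod>k<n. Barnes_factor w k) * (N + 1 + w) ^ n * (N + 1 + w) *
      (exp ((w + 1 / 2) * (harm n - l)) * exp (- N) * exp (l / 2) / N) / fact n =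
      (\<Prod>k<n. Barnes_factor w k) * (((N + 1 + w) / N) ^ n * ((N + 1 + w) / N) *
      exp ((w + 1 / 2) * (harm n - l)) * (N ^ n * exp (l / 2) * exp (- N) / fact n))"
    by (simp add: power_divide)
  also have "(N + 1 + w) / N = 1 + (w + 1) / N" by (simp add: field_simps)
  also have "N ^ n * exp (l / 2) * exp (- N) / fact n = of_real (Stirling_ratio n)"
    by (simp add: Stirling_ratio_def sq N_def exp_of_real[symmetric])
  finally show ?thesis by (simp add: N_def l_def of_real_harm)
qed

lemma wallis_product_fact:
  "(\<Prod>k=1..n. (4 * real k ^ 2) / (4 * real k ^ 2 - 1)) =
     16 ^ n * fact n ^ 4 / (fact (2 * n) ^ 2 * (2 * real n + 1))"
proof (induction n)
  case (Suc n)
  have "4 * real (Suc n) ^ 2 - 1 = (2 * real n + 1) * (2 * real n + 3)"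
    by (simp add: algebra_simps power2_eq_square)
  moreover have "fact (2 * Suc n) = (2 * real n + 2) * (2 * real n + 1) * (fact (2 * n) :: real)"
    by (simp add: algebra_simps)
  moreover have "(16 ^ n * F ^ 4 / (D ^ 2 * a)) * (4 * s ^ 2 / (a * b)) =
      16 ^ Suc n * (s * F) ^ 4 / ((2 * s * a * D) ^ 2 * b)"
    if "a \<noteq> 0" "b \<noteq> 0" "s \<noteq> 0" "D \<noteq> 0" for a b s D F :: real
    using that by (simp add: divide_simps power2_eq_square power4_eq_xxxx)
  from this[of "2 * real n + 1" "2 * real n + 3" "real n + 1" "fact (2 * n)" "fact n"]
  have "(16 ^ n * fact n ^ 4 / (fact (2 * n) ^ 2 * (2 * real n + 1))) *
      (4 * (real n + 1) ^ 2 / ((2 * real n + 1) * (2 * real n + 3))) =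
      16 ^ Suc n * ((real n + 1) * fact n) ^ 4 / ((2 * (real n + 1) * (2 * real n + 1) * fact (2 * n)) ^ 2 * (2 * real n + 3))"
    by (simp add: add_nonneg_eq_0_iff)
  ultimately show ?case
    using Suc by (simp add: algebra_simps)
qed auto

text \<open>In \<open>S(n)^2 / S(2 n)\<close> the exponentials and the powers \<open>n^n\<close>
  cancel, and a central binomial coefficient remains, whose square is given by Wallis's product. If
  \<open>S\<close> has a nonzero limit \<open>L\<close>, the quotient tends to \<open>L\<close> as
  well, which fixes its value.\<close>

lemma Stirling_ratio_duplication:
  assumes "n > 0"
  shows "(Stirling_ratio n ^ 2 / Stirling_ratio (2 * n)) ^ 2 =
    1 / (2 * (\<Prod>k=1..n. (4 * real k ^ 2) / (4 * real k ^ 2 - 1))) * (real n / (2 * real n + 1))"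
proof -
  have sq: "sqrt (real n) ^ 2 = real n" "sqrt (real (2 * n)) ^ 2 = 2 * real n" by simp_all
  have e: "exp (- real n) ^ 4 = exp (- real (2 * n)) ^ 2"
    by (simp flip: exp_of_nat_mult)
  have "(Stirling_ratio n ^ 2 / Stirling_ratio (2 * n)) ^ 2 =
     (real n ^ n) ^ 4 * (sqrt (real n) ^ 2) ^ 2 * exp (- real n) ^ 4 * fact (2 * n) ^ 2 /
     (fact n ^ 4 * (((2 * real n) ^ (2 * n)) ^ 2 * sqrt (real (2 * n)) ^ 2 * exp (- real (2 * n)) ^ 2))"
  proof -
    have "((P * s * E / f) ^ 2 / (P' * s' * E' / f')) ^ 2 =
        P ^ 4 * (s ^ 2) ^ 2 * E ^ 4 * f' ^ 2 / (f ^ 4 * (P' ^ 2 * s' ^ 2 * E' ^ 2))"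
      for P s E f P' s' E' f' :: real
      by (simp add: power_mult_distrib power_divide flip: power_mult)
    from this[of "real n ^ n" "sqrt (real n)" "exp (- real n)" "fact n" "real (2 * n) ^ (2 * n)"
        "sqrt (real (2 * n))" "exp (- real (2 * n))" "fact (2 * n)"]
    show ?thesis unfolding Stirling_ratio_def by simp
  qed
  also have "((2 * real n) ^ (2 * n)) ^ 2 = 16 ^ n * (real n ^ n) ^ 4"
    by (simp add: power_mult_distrib mult.commute[of n] flip: power_mult) (simp add: power_mult)
  also have "(real n ^ n) ^ 4 * (sqrt (real n) ^ 2) ^ 2 * exp (- real n) ^ 4 * fact (2 * n) ^ 2 /
     (fact n ^ 4 * (16 ^ n * (real n ^ n) ^ 4 * sqrt (real (2 * n)) ^ 2 * exp (- real (2 * n)) ^ 2)) =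
     real n * fact (2 * n) ^ 2 / (2 * 16 ^ n * fact n ^ 4)"
  proof -
    have four: "((2 :: real) ^ n) ^ 4 = 16 ^ n"
      by (simp add: mult.commute[of n] flip: power_mult) (simp add: power_mult)
    have "P ^ 4 * x ^ 2 * E * d / (f * (s * P ^ 4 * (2 * x) * E)) = x * d / (2 * s * f)"
      if "x \<noteq> 0" "P \<noteq> 0" "E \<noteq> 0" for P x E d f s :: real
      using that by (simp add: divide_simps power2_eq_square)
    from this[of "real n" "real n ^ n" "exp (- real (2 * n)) ^ 2" "fact (2 * n) ^ 2" "fact n ^ 4" "16 ^ n"]
    show ?thesis unfolding e sq using assms by (simp add: four)
  qed
  also have "\<dots> = 1 / (2 * (16 ^ n * fact n ^ 4 / (fact (2 * n) ^ 2 * (2 * real n + 1)))) * (real n / (2 * real n + 1))"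
  proof -
    have "2 * real n + 1 \<noteq> 0" by linarith
    thus ?thesis by (simp add: divide_simps)
  qed
  finally show ?thesis unfolding wallis_product_fact .
qed

text \<open>At \<open>w = 0\<close> the product on the right of \<open>Barnes_partial_rGamma\<close>
  equals 1, so convergence of the product at \<open>w = 1\<close> forces
  \<open>Stirling_ratio\<close> to have a nonzero limit. Duplication gives the square of the limit,
  nonnegativity its sign.\<close>

lemma Stirling_ratio_LIMSEQ: "Stirling_ratio \<longlonglongrightarrow> 1 / sqrt (2 * pi)"
proof -
  define h where "h = (\<lambda>n. (1 + 1 / real n) ^ n * (1 + 1 / real n) * exp ((harm n - ln (real n)) / 2))"
  have h: "h \<longlonglongrightarrow> exp 1 * (1 + 0) * exp (euler_mascheroni / 2)"
    unfolding h_def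
    by (intro tendsto_intros tendsto_exp_limit_sequentially lim_1_over_n euler_mascheroni_LIMSEQ) auto
  have hpos: "h n > 0" if "n > 0" for n
    using that by (auto simp: h_def intro!: mult_pos_pos zero_less_power add_pos_nonneg)
  define p where "p = prodinf (Barnes_factor 1)"
  have p0: "p \<noteq> 0"
    using Barnes_G_nonzero[of 2] Barnes_G_1_plus[of 1] by (auto simp: p_def)
  have one: "(\<Prod>k<n. Barnes_factor 0 k) = 1" for n by (simp add: Barnes_factor_def)
  have fin: "(\<Prod>k<n. Barnes_factor 1 k) * rGamma_series 1 n = of_real (h n * Stirling_ratio n)" if "n > 0" for n
    using Barnes_partial_rGamma[OF that, of 0]
    by (simp add: one h_def exp_of_real[symmetric] mult_ac of_real_harm)
  have "(\<lambda>n. (\<Prod>k<n. Barnes_factor 1 k) * rGamma_series 1 n) \<longlonglongrightarrow> p"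
    unfolding p_def by (subst mult_1_right[of "prodinf _", symmetric], subst rGamma_1[symmetric]) (intro tendsto_mult Barnes_partial_LIMSEQ rGamma_series_LIMSEQ)
  moreover have "\<forall>\<^sub>F n in sequentially. (\<Prod>k<n. Barnes_factor 1 k) * rGamma_series 1 n = of_real (h n * Stirling_ratio n)"
    using eventually_gt_at_top[of "0 :: nat"] by eventually_elim (rule fin)
  ultimately have "(\<lambda>n. complex_of_real (h n * Stirling_ratio n)) \<longlonglongrightarrow> p"
    by (rule Lim_transform_eventually)
  from tendsto_Re[OF this] tendsto_Im[OF this]
  have hS: "(\<lambda>n. h n * Stirling_ratio n) \<longlonglongrightarrow> Re p" and "Im p = 0"
    by (simp_all add: tendsto_const_iff)
  with p0 have p0': "Re p \<noteq> 0" by (auto simp: complex_eq_iff)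
  define L where "L = Re p / (exp 1 * (1 + 0) * exp (euler_mascheroni / 2))"
  have "(\<lambda>n. h n * Stirling_ratio n / h n) \<longlonglongrightarrow> L"
    unfolding L_def by (intro tendsto_divide hS h) auto
  moreover have "\<forall>\<^sub>F n in sequentially. h n * Stirling_ratio n / h n = Stirling_ratio n"
    using eventually_gt_at_top[of "0 :: nat"]
  proof eventually_elim
    case (elim n)
    show ?case using hpos[OF elim] by simp
  qed
  ultimately have S: "Stirling_ratio \<longlonglongrightarrow> L"
    by (rule Lim_transform_eventually)
  have L0: "L \<noteq> 0" using p0' by (simp add: L_def)
  have "L \<ge> 0"
    by (rule LIMSEQ_le_const[OF S]) (auto simp: Stirling_ratio_def)
  have S2: "(\<lambda>n. Stirling_ratio (2 * n)) \<longlonglongrightarrow> L"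
    by (rule filterlim_compose[OF S]) (rule mult_nat_left_at_top, simp)
  have lim1: "(\<lambda>n. (Stirling_ratio n ^ 2 / Stirling_ratio (2 * n)) ^ 2) \<longlonglongrightarrow> (L ^ 2 / L) ^ 2"
    by (intro tendsto_intros S S2 L0)
  have fr: "(\<lambda>n. real n / (2 * real n + 1)) \<longlonglongrightarrow> 1 / 2" by real_asymp
  have lim2: "(\<lambda>n. 1 / (2 * (\<Prod>k=1..n. (4 * real k ^ 2) / (4 * real k ^ 2 - 1))) * (real n / (2 * real n + 1)))
     \<longlonglongrightarrow> 1 / (2 * (pi / 2)) * (1 / 2)"
    by (rule tendsto_mult[OF tendsto_divide[OF tendsto_const tendsto_mult[OF tendsto_const wallis]] fr]) simp
  have "(\<lambda>n. (Stirling_ratio n ^ 2 / Stirling_ratio (2 * n)) ^ 2) \<longlonglongrightarrow> 1 / (2 * (pi / 2)) * (1 / 2)"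
  proof (rule Lim_transform_eventually[OF lim2])
    show "\<forall>\<^sub>F n in sequentially. 1 / (2 * (\<Prod>k=1..n. (4 * real k ^ 2) / (4 * real k ^ 2 - 1))) *
        (real n / (2 * real n + 1)) = (Stirling_ratio n ^ 2 / Stirling_ratio (2 * n)) ^ 2"
      using eventually_gt_at_top[of "0 :: nat"] by eventually_elim (simp only: Stirling_ratio_duplication)
  qed
  from LIMSEQ_unique[OF lim1 this] have "L ^ 2 = 1 / (2 * pi)"
    using L0 by (simp add: power2_eq_square)
  hence "L = 1 / sqrt (2 * pi)"
    using \<open>L \<ge> 0\<close> by (metis real_sqrt_divide real_sqrt_one real_sqrt_unique)
  with S show ?thesis by simp
qed

text \<open>Both sides of \<open>Barnes_partial_rGamma\<close> converge and the limits are compared.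
  Writing \<open>rGamma\<close> on the left instead of \<open>Gamma\<close> on the right includes
  the poles.\<close>

lemma Barnes_G_shift: "Barnes_G (z + 1) * rGamma z = Barnes_G z"
proof -
  define w where "w = z - 1"
  have sq0: "complex_of_real (sqrt (2 * pi)) \<noteq> 0" by simp
  have "(\<lambda>n. (\<Prod>k<n. Barnes_factor w k) *
     ((1 + (w + 1) / of_nat n) ^ n * (1 + (w + 1) / of_nat n) *
      exp ((w + 1 / 2) * of_real (harm n - ln (of_nat n))) * of_real (Stirling_ratio n))) \<longlonglongrightarrow>
     prodinf (Barnes_factor w) * (exp (w + 1) * (1 + 0) * exp ((w + 1 / 2) * euler_mascheroni) *
       of_real (1 / sqrt (2 * pi)))" (is "?f \<longlonglongrightarrow> _")
    by (intro tendsto_intros Barnes_partial_LIMSEQ tendsto_exp_limit_complex lim_const_over_n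
          euler_mascheroni_LIMSEQ_of_real Stirling_ratio_LIMSEQ)
  moreover have "?f \<longlonglongrightarrow> prodinf (Barnes_factor (w + 1)) * rGamma (w + 1)"
  proof (rule Lim_transform_eventually[OF tendsto_mult[OF Barnes_partial_LIMSEQ rGamma_series_LIMSEQ]])
    show "\<forall>\<^sub>F n in sequentially. (\<Prod>k<n. Barnes_factor (w + 1) k) * rGamma_series (w + 1) n = ?f n"
      using eventually_gt_at_top[of "0 :: nat"] by eventually_elim (rule Barnes_partial_rGamma)
  qed
  ultimately have P: "prodinf (Barnes_factor (w + 1)) * rGamma (w + 1) =
      prodinf (Barnes_factor w) * (exp (w + 1) * exp ((w + 1 / 2) * euler_mascheroni) / of_real (sqrt (2 * pi)))"
    by (auto dest: LIMSEQ_unique)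
  have half: "(2 * complex_of_real pi) powr (1 / 2) = of_real (sqrt (2 * pi))"
    using powr_of_real[of "2 * pi" "1 / 2"] by (simp add: powr_half_sqrt)
  have pw: "(2 * complex_of_real pi) powr ((w + 1) / 2) = (2 * of_real pi) powr (w / 2) * of_real (sqrt (2 * pi))"
    unfolding half[symmetric] add_divide_distrib by (rule powr_add)
  \<comment> \<open>The prefactors in \<open>Barnes_G\<close> are made for this step: under
    \<open>w \<mapsto> w + 1\<close> they change by exactly the inverse of the factor in
    \<open>P\<close>.\<close>
  have ex: "exp (- (w + w ^ 2 * (1 + euler_mascheroni)) / 2) =
      exp (- ((w + 1) + (w + 1) ^ 2 * (1 + euler_mascheroni)) / 2) *
      (exp (w + 1) * exp ((w + 1 / 2) * (euler_mascheroni :: complex)))"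
    unfolding mult_exp_exp by (rule arg_cong[where f = exp]) (simp add: field_simps power2_eq_square)
  have "Barnes_G (1 + (w + 1)) * rGamma (w + 1) = Barnes_G (1 + w)"
    unfolding Barnes_G_1_plus pw ex mult.assoc P using sq0 by simp
  thus ?thesis by (simp add: w_def add_ac)
qed

section \<open>Recurrences for determinants of Bessel functions\<close>

text \<open>The factor of \<open>Bessel_J \<nu> x\<close> beside its power, in the variable
  \<open>y = x / 2\<close>; it is even and entire in \<open>y\<close>, so no branch enters.\<close>

definition bessel_series :: "complex \<Rightarrow> complex \<Rightarrow> complex" where
  "bessel_series \<nu> y = (\<Sum>k. (-1) ^ k * rGamma (\<nu> + of_nat k + 1) / fact k * y ^ (2 * k))"

text \<open>Here \<open>z\<close> stands for \<open>y ^ 2\<close>. The recurrence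
  \<open>rGamma u = u * rGamma (u + 1)\<close> compares consecutive terms without dividing by values
  of \<open>rGamma\<close> that may vanish.\<close>

lemma bessel_series_summable:
  fixes z \<nu> :: complex
  shows "summable (\<lambda>k. (-1) ^ k * rGamma (\<nu> + of_nat k + 1) / fact k * z ^ k)" (is "summable ?f")
proof -
  obtain N :: nat where N: "real N > 2 * norm z + norm \<nu> + 1" using reals_Archimedean2 by blast
  show ?thesis
  \<comment> \<open>Beyond \<open>N\<close>, both \<open>norm z / (k + 1) \<le> 1 / 2\<close> and
    \<open>norm (\<nu> + k + 1) \<ge> 1\<close> hold, whence the ratio 1/2.\<close>
  proof (rule summable_ratio_test[of "1 / 2" N])
    fix k assume k: "k \<ge> N"
    define r where "r = norm (rGamma (\<nu> + of_nat k + 2))"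
    have g: "rGamma (\<nu> + of_nat k + 1) = (\<nu> + of_nat k + 1) * rGamma (\<nu> + of_nat k + 2)"
      using rGamma_plus1[of "\<nu> + of_nat k + 1"] by (simp add: add.assoc)
    have kN: "real N \<le> real k" using k by simp
    have "2 * norm z + norm \<nu> + 1 < real k" by (rule less_le_trans[OF N kN])
    moreover have "0 \<le> norm \<nu>" by (rule norm_ge_zero)
    ultimately have "2 * norm z \<le> real k + 1" by linarith
    hence k1: "norm z \<le> (real k + 1) / 2" by simp
    have "norm (of_nat (k + 1) :: complex) - norm (- \<nu>) \<le> norm (of_nat (k + 1) - (- \<nu>))"
      by (rule norm_triangle_ineq2)
    hence "real k + 1 - norm \<nu> \<le> norm (\<nu> + of_nat k + 1)" by (simp add: add_ac del: norm_of_nat) (simp add: add_ac flip: of_nat_Suc)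
    hence k2: "1 \<le> norm (\<nu> + of_nat k + 1)" using kN N norm_ge_zero[of z] by linarith
    have "norm (?f (Suc k)) = r * (norm z / (real k + 1)) * (norm z ^ k / fact k)"
      by (simp add: norm_mult norm_divide norm_power r_def add_ac del: fact_Suc) (simp add: field_simps)
    also have "\<dots> \<le> r * (1 / 2) * (norm z ^ k / fact k)"
      using k1 by (intro mult_right_mono mult_left_mono) (auto simp: r_def field_simps)
    also have "\<dots> \<le> r * (1 / 2 * norm (\<nu> + of_nat k + 1)) * (norm z ^ k / fact k)"
      using k2 by (intro mult_right_mono mult_left_mono) (auto simp: r_def)
    also have "\<dots> = 1 / 2 * norm (?f k)"
      unfolding g by (simp add: norm_mult norm_divide norm_power r_def)
    finally show "norm (?f (Suc k)) \<le> 1 / 2 * norm (?f k)" .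
  qed simp
qed

lemma bessel_series_at_0: "(bessel_series \<nu> \<longlongrightarrow> rGamma (\<nu> + 1)) (at 0)"
proof -
  define c where "c = (\<lambda>k. (-1) ^ k * rGamma (\<nu> + of_nat k + 1) / fact k)"
  have "((\<lambda>z. \<Sum>k. c k * z ^ k) \<longlongrightarrow> c 0) (at 0)"
    by (rule powser_limit_0[of 1]) (use bessel_series_summable[of \<nu>] in \<open>auto simp: c_def summable_sums\<close>)
  moreover have "filterlim (\<lambda>y :: complex. y ^ 2) (at 0) (at 0)"
    by (rule filterlim_atI) (auto intro!: tendsto_eq_intros simp: eventually_at_filter)
  ultimately have "((\<lambda>y. \<Sum>k. c k * (y ^ 2) ^ k) \<longlongrightarrow> c 0) (at 0)"
    by (rule filterlim_compose)
  thus ?thesis by (simp add: bessel_series_def[abs_def] c_def power_mult)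
qed

text \<open>
  With \<open>y = x / 2\<close>, the entries of the Toeplitz matrix are \<open>toeplitz_symbol a U V y m\<close> for
  \<open>a = \<alpha> / 2\<close>, \<open>U\<close> a multiple of \<open>y powr a\<close> and \<open>V\<close> a multiple of \<open>y powr (-a)\<close>. All the
  multivaluedness sits in \<open>U\<close> and \<open>V\<close>, which are treated as independent variables.
\<close>

definition toeplitz_symbol :: "complex \<Rightarrow> complex \<Rightarrow> complex \<Rightarrow> complex \<Rightarrow> int \<Rightarrow> complex" where
  "toeplitz_symbol a U V y m = U * y powi m * bessel_series (a + of_int m) y +
     V * (-1) powi m * y powi (-m) * bessel_series (- a - of_int m) y"

definition bessel_det :: "nat \<Rightarrow> complex \<Rightarrow> complex \<Rightarrow> complex \<Rightarrow> complex \<Rightarrow> complex" where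
  "bessel_det n a U V y = toeplitz_det n (toeplitz_symbol a U V y)"

text \<open>\<open>U\<close> and \<open>V\<close> absorb the extra power of \<open>y\<close> and the
  sign. By this and the next lemma, determinants with a shifted symbol stay in the family
  \<open>bessel_det\<close>, which makes an induction possible.\<close>

lemma toeplitz_symbol_plus1:
  assumes "y \<noteq> 0"
  shows "toeplitz_symbol a U V y (m + 1) = toeplitz_symbol (a + 1) (U * y) (- V / y) y m"
proof -
  have "- (a + 1) - of_int m = - a - of_int (m + 1)" by simp
  moreover have "a + 1 + of_int m = a + of_int (m + 1)" by simp
  ultimately show ?thesis
    unfolding toeplitz_symbol_def using assms
    by (simp only:) (simp add: power_int_add power_int_diff power_int_minus field_simps del: of_int_add of_int_diff)
qed

lemma toeplitz_symbol_minus1: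
  assumes "y \<noteq> 0"
  shows "toeplitz_symbol a U V y (m - 1) = toeplitz_symbol (a - 1) (U / y) (- V * y) y m"
proof -
  have "- (a - 1) - of_int m = - a - of_int (m - 1)" by simp
  moreover have "a - 1 + of_int m = a + of_int (m - 1)" by simp
  ultimately show ?thesis
    unfolding toeplitz_symbol_def using assms
    by (simp only:) (simp add: power_int_add power_int_diff power_int_minus field_simps del: of_int_add of_int_diff)
qed

lemma toeplitz_det_scale: "toeplitz_det n (\<lambda>m. c * e m) = c ^ n * toeplitz_det n e"
proof -
  have "Matrix.mat n n (\<lambda>(j, k). c * e (int k - int j)) = c \<cdot>\<^sub>m Matrix.mat n n (\<lambda>(j, k). e (int k - int j))"
    by (rule eq_matI) auto
  thus ?thesis by (simp add: toeplitz_det_def)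
qed

lemma bessel_det_scale: "bessel_det n a (c * U) (c * V) y = c ^ n * bessel_det n a U V y"
  unfolding bessel_det_def toeplitz_det_scale[symmetric]
  by (simp add: toeplitz_symbol_def[abs_def] algebra_simps)

lemma toeplitz_det_0 [simp]: "toeplitz_det 0 e = 1"
  by (simp add: toeplitz_det_def)

lemma toeplitz_det_1 [simp]: "toeplitz_det (Suc 0) e = e 0"
  by (simp add: toeplitz_det_def det_single)

lemma bessel_det_condensation:
  assumes "y \<noteq> 0"
  shows "bessel_det (n + 2) a U V y * bessel_det n a U V y =
    bessel_det (n + 1) a U V y ^ 2 -
    bessel_det (n + 1) (a + 1) (U * y) (- V / y) y * bessel_det (n + 1) (a - 1) (U / y) (- V * y) y"
  using toeplitz_det_condensation[of n "toeplitz_symbol a U V y"]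
  unfolding bessel_det_def toeplitz_symbol_plus1[OF assms] toeplitz_symbol_minus1[OF assms] .

text \<open>
  The substitution \<open>U = w y\<^sup>\<sigma>\<close>, \<open>V = 1\<close> singles out one power of \<open>w\<close> in the limit \<open>y \<rightarrow> 0\<close>. For odd
  \<open>\<sigma>\<close> there is never a tie between two powers, also in the determinants of smaller order.
\<close>

definition weighted_det :: "nat \<Rightarrow> complex \<Rightarrow> int \<Rightarrow> complex \<Rightarrow> complex \<Rightarrow> complex" where
  "weighted_det n a \<sigma> w y = bessel_det n a (w * y powi \<sigma>) 1 y"

text \<open>Normalising \<open>V\<close> to 1 again after a shift of the symbol turns
  \<open>\<sigma>\<close> into \<open>\<sigma> \<plusminus> 2\<close> and \<open>w\<close> into
  \<open>- w\<close>. The scalars taken out, powers of \<open>- 1 / y\<close> and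
  \<open>- y\<close>, cancel in the product.\<close>

lemma weighted_det_condensation:
  assumes y: "y \<noteq> 0"
  shows "weighted_det (n + 2) a \<sigma> w y * weighted_det n a \<sigma> w y =
    weighted_det (n + 1) a \<sigma> w y ^ 2 -
    weighted_det (n + 1) (a + 1) (\<sigma> + 2) (- w) y * weighted_det (n + 1) (a - 1) (\<sigma> - 2) (- w) y"
proof -
  have e1: "bessel_det (n + 1) (a + 1) (w * y powi \<sigma> * y) (- 1 / y) y =
      (- 1 / y) ^ (n + 1) * weighted_det (n + 1) (a + 1) (\<sigma> + 2) (- w) y"
    unfolding weighted_det_def bessel_det_scale[symmetric]
    using y by (simp add: power_int_add power2_eq_square mult.assoc)
  have e2: "bessel_det (n + 1) (a - 1) (w * y powi \<sigma> / y) (- 1 * y) y =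
      (- y) ^ (n + 1) * weighted_det (n + 1) (a - 1) (\<sigma> - 2) (- w) y"
    unfolding weighted_det_def bessel_det_scale[symmetric]
    using y by (simp add: power_int_diff power2_eq_square)
  have one: "(- 1 / y) ^ (n + 1) * (- y) ^ (n + 1) = 1"
    unfolding power_mult_distrib[symmetric] using y by simp
  have "(c * p) * (d * q) = (c * d) * (p * q)" for c d p q :: complex by simp
  from this[of "(- 1 / y) ^ (n + 1)" _ "(- y) ^ (n + 1)"] show ?thesis
    using bessel_det_condensation[OF y, of n a "w * y powi \<sigma>" 1]
    unfolding e1 e2 one by (simp only: mult_1_left weighted_det_def)
qed

text \<open>This says that \<open>leading_exponent n i \<sigma>\<close> has its strict minimum over
  \<open>i \<le> n\<close> at \<open>j\<close>: it is convex in \<open>i\<close>, so comparing with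
  the neighbours \<open>j - 1\<close> and \<open>j + 1\<close> is enough.\<close>

definition dominant :: "nat \<Rightarrow> nat \<Rightarrow> int \<Rightarrow> bool" where
  "dominant n j \<sigma> \<longleftrightarrow> j \<le> n \<and> (j = 0 \<or> \<sigma> - 2 * int n + 4 * int j < 2) \<and>
     (j = n \<or> \<sigma> - 2 * int n + 4 * int j > - 2)"

text \<open>The order in \<open>y\<close> of the term with \<open>w ^ j\<close>: the first summand
  comes from \<open>U ^ j\<close>, the second is the order of the coefficient
  \<open>F_j\<close>.\<close>

definition leading_exponent :: "nat \<Rightarrow> nat \<Rightarrow> int \<Rightarrow> int" where
  "leading_exponent n j \<sigma> = \<sigma> * int j - 2 * int j * (int n - int j)"

definition has_leading_term :: "nat \<Rightarrow> nat \<Rightarrow> complex \<Rightarrow> int \<Rightarrow> complex \<Rightarrow> complex \<Rightarrow> bool" where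
  "has_leading_term n j a \<sigma> w l \<longleftrightarrow>
     ((\<lambda>y. weighted_det n a \<sigma> w y * y powi (- leading_exponent n j \<sigma>)) \<longlongrightarrow> l) (at 0)"

text \<open>The condensation identity is divided by the determinant of order \<open>n\<close>, so
  \<open>l0\<close> must be nonzero. \<open>d\<close> is the surplus order of the square: it counts
  fully for \<open>d = 0\<close>, as \<open>0 ^ 0 = 1\<close>, and drops out for
  \<open>d > 0\<close>.\<close>

lemma has_leading_term_condensation:
  assumes "has_leading_term n j0 a \<sigma> w l0" "l0 \<noteq> 0"
    and "has_leading_term (n + 1) j1 a \<sigma> w l1"
    and "has_leading_term (n + 1) jp (a + 1) (\<sigma> + 2) (- w) lp"
    and "has_leading_term (n + 1) jm (a - 1) (\<sigma> - 2) (- w) lm"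
    and e: "leading_exponent (n + 1) jp (\<sigma> + 2) + leading_exponent (n + 1) jm (\<sigma> - 2) =
       leading_exponent (n + 2) j \<sigma> + leading_exponent n j0 \<sigma>"
    and d: "2 * leading_exponent (n + 1) j1 \<sigma> =
       leading_exponent (n + 2) j \<sigma> + leading_exponent n j0 \<sigma> + int d"
  shows "has_leading_term (n + 2) j a \<sigma> w ((l1 ^ 2 * 0 ^ d - lp * lm) / l0)"
proof -
  define T where "T = (\<lambda>n a s w j y. weighted_det n a s w y * y powi (- leading_exponent n j s))"
  have "((\<lambda>y. (T (n + 1) a \<sigma> w j1 y ^ 2 * y ^ d - T (n + 1) (a + 1) (\<sigma> + 2) (- w) jp y *
      T (n + 1) (a - 1) (\<sigma> - 2) (- w) jm y) / T n a \<sigma> w j0 y) \<longlongrightarrow> (l1 ^ 2 * 0 ^ d - lp * lm) / l0) (at 0)"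
    using assms unfolding has_leading_term_def T_def by (intro tendsto_intros) auto
  moreover have "\<forall>\<^sub>F y in at 0. T n a \<sigma> w j0 y \<noteq> 0"
    using assms(1,2) unfolding has_leading_term_def T_def by (rule tendsto_imp_eventually_ne)
  hence "\<forall>\<^sub>F y in at 0. (T (n + 1) a \<sigma> w j1 y ^ 2 * y ^ d - T (n + 1) (a + 1) (\<sigma> + 2) (- w) jp y *
      T (n + 1) (a - 1) (\<sigma> - 2) (- w) jm y) / T n a \<sigma> w j0 y = T (n + 2) a \<sigma> w j y"
    using eventually_neq_at_within[of 0 0 UNIV]
  proof eventually_elim
    case (elim y)
    note y = elim(2)
    define p where "p = y powi (- leading_exponent (n + 2) j \<sigma>) * y powi (- leading_exponent n j0 \<sigma>)"
    have p1: "y powi (- leading_exponent (n + 1) jp (\<sigma> + 2)) * y powi (- leading_exponent (n + 1) jm (\<sigma> - 2)) = p"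
      unfolding p_def power_int_add[OF disjI1[OF y], symmetric]
      by (rule arg_cong[where f = "\<lambda>k. y powi k"]) (use e in simp)
    have p2: "(y powi (- leading_exponent (n + 1) j1 \<sigma>)) ^ 2 * y ^ d = p"
      unfolding p_def power2_eq_square power_int_of_nat[of y d, symmetric] power_int_add[OF disjI1[OF y], symmetric]
      by (rule arg_cong[where f = "\<lambda>k. y powi k"]) (use d in simp)
    have "T (n + 1) a \<sigma> w j1 y ^ 2 * y ^ d - T (n + 1) (a + 1) (\<sigma> + 2) (- w) jp y *
        T (n + 1) (a - 1) (\<sigma> - 2) (- w) jm y =
        (weighted_det (n + 1) a \<sigma> w y ^ 2 -
          weighted_det (n + 1) (a + 1) (\<sigma> + 2) (- w) y * weighted_det (n + 1) (a - 1) (\<sigma> - 2) (- w) y) * p"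
    proof -
      have "(u * q) ^ 2 * x - v * r * (v' * r') = (u ^ 2 - v * v') * p"
        if "q ^ 2 * x = p" "r * r' = p" for u v v' q r r' x :: complex
      proof -
        have "(u * q) ^ 2 * x - v * r * (v' * r') = u ^ 2 * (q ^ 2 * x) - v * v' * (r * r')"
          by (simp add: power_mult_distrib)
        thus ?thesis by (simp add: that left_diff_distrib)
      qed
      from this[OF p2 p1] show ?thesis unfolding T_def .
    qed
    also have "\<dots> = T (n + 2) a \<sigma> w j y * T n a \<sigma> w j0 y"
      unfolding weighted_det_condensation[OF y, symmetric] T_def p_def by (simp only: mult_ac)
    finally show ?case using elim by simp
  qed
  ultimately show ?thesis
    unfolding has_leading_term_def T_def by (rule Lim_transform_eventually)
qed

section \<open>Leading coefficients\<close>

text \<open>This is kappa. The sine compensates denominators in \<open>U\<close> and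
  \<open>V\<close>; the sign exponent \<open>j n + n\<close> becomes \<open>j (n - 1)\<close> modulo
  2 once the sign of \<open>(- d2) ^ (n - j)\<close> is added.\<close>

definition det_coeff :: "nat \<Rightarrow> nat \<Rightarrow> complex \<Rightarrow> complex" where
  "det_coeff n j a = (-1) ^ (n * (n + 1) div 2 + j * n + n) * (sin (of_real pi * a) / of_real pi) ^ n *
     (Barnes_G (of_nat n - of_nat j + 1) * Barnes_G (- a + of_nat n - of_nat j + 1) *
      Barnes_G (of_nat j + 1) * Barnes_G (of_nat j + a + 1) /
      (Barnes_G (- a + of_nat n - 2 * of_nat j + 1) * Barnes_G (a - of_nat n + 2 * of_nat j + 1)))"

lemma notin_Ints_add_of_int: "z \<notin> \<int> \<Longrightarrow> z + of_int m \<notin> \<int>" for z :: complex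
  by (metis Ints_diff Ints_of_int add_diff_cancel_right')

lemma Barnes_G_shift_nonzero:
  assumes "a \<notin> \<int>"
  shows "Barnes_G (a + of_int m) \<noteq> 0"
  by (rule Barnes_G_nonzero) (use notin_Ints_add_of_int[OF assms] nonpos_Ints_subset_Ints in blast)

lemma Barnes_G_of_nat_nonzero: "Barnes_G (of_nat n + 1) \<noteq> 0"
  by (rule Barnes_G_nonzero) (metis of_nat_Suc add.commute of_nat_in_nonpos_Ints_iff nat.distinct(1) )

lemma sin_pi_nonzero:
  assumes "a \<notin> \<int>"
  shows "sin (of_real pi * a) \<noteq> (0 :: complex)"
proof
  assume "sin (of_real pi * a) = 0"
  then obtain m :: int where "of_real pi * a = of_real (of_int m * pi)"
    unfolding sin_eq_0 by (auto simp: mult.commute)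
  hence "a = of_int m" by (simp add: mult.commute)
  with assms show False by auto
qed

text \<open>All Barnes arguments containing \<open>a\<close> are nonintegers, and the other two are
  positive integers because \<open>j \<le> n\<close>.\<close>

lemma det_coeff_nonzero:
  assumes a: "a \<notin> \<int>" and j: "j \<le> n"
  shows "det_coeff n j a \<noteq> 0"
proof -
  have "- a \<notin> \<int>" using a by (metis Ints_minus minus_minus)
  note g = Barnes_G_shift_nonzero[OF a] Barnes_G_shift_nonzero[OF this]
  have "Barnes_G (of_nat n - of_nat j + 1) \<noteq> 0"
    using Barnes_G_of_nat_nonzero[of "n - j"] j by (simp add: of_nat_diff)
  thus ?thesis
    unfolding det_coeff_def
    using g(2)[of "int n - int j + 1"] g(1)[of "int j + 1"] g(2)[of "int n - 2 * int j + 1"]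
      g(1)[of "2 * int j - int n + 1"] sin_pi_nonzero[OF a] Barnes_G_of_nat_nonzero[of j]
    by (simp add: algebra_simps)
qed

lemma det_coeff_0:
  assumes "a \<notin> \<int>"
  shows "det_coeff n 0 a = (-1) ^ (n * (n + 1) div 2 + n) * (sin (of_real pi * a) / of_real pi) ^ n *
     (Barnes_G (of_nat n + 1) * Barnes_G (a + 1) / Barnes_G (a - of_nat n + 1))"
proof -
  have "- a \<notin> \<int>" using assms by (metis Ints_minus minus_minus)
  from Barnes_G_shift_nonzero[OF this, of "int n + 1"]
  have "Barnes_G (- a + of_nat n + 1) \<noteq> 0" by (simp add: add_ac)
  thus ?thesis by (simp add: det_coeff_def add_ac)
qed

lemma det_coeff_self:
  assumes "a \<notin> \<int>"
  shows "det_coeff n n a = (-1) ^ (n * (n + 1) div 2) * (sin (of_real pi * a) / of_real pi) ^ n *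
     (Barnes_G (of_nat n + 1) * Barnes_G (- a + 1) / Barnes_G (- a - of_nat n + 1))"
proof -
  from Barnes_G_shift_nonzero[OF assms, of "int n + 1"]
  have g: "Barnes_G (of_nat n + a + 1) \<noteq> 0" by (simp add: add_ac)
  have e: "- a + of_nat n - 2 * of_nat n + 1 = - a - of_nat n + 1" "a - of_nat n + 2 * of_nat n + 1 = of_nat n + a + 1"
    "- a + of_nat n - of_nat n + 1 = - a + 1" "of_nat n - of_nat n + 1 = (1 :: complex)"
    by simp_all
  have "(-1 :: complex) ^ (n * (n + 1) div 2 + n * n + n) = (-1) ^ (n * (n + 1) div 2)"
    by (subst add.assoc, subst power_add) (simp add: minus_one_power_iff)
  thus ?thesis unfolding det_coeff_def e using g by simp
qed

section \<open>Recurrences for the leading coefficients\<close>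

lemma Barnes_G_plus1:
  assumes "z \<notin> \<int>\<^sub>\<le>\<^sub>0"
  shows "Barnes_G (z + 1) = Gamma z * Barnes_G z"
  using Barnes_G_shift[of z] assms by (auto simp: Gamma_def field_simps rGamma_eq_zero_iff)

text \<open>The triangular numbers of index \<open>n\<close> and \<open>n + 2\<close> have an odd
  sum. This accounts for the minus on the left of \<open>Barnes_quotient_step\<close>.\<close>

lemma triangular_sign_step:
  "(-1) ^ ((n + 2) * (n + 3) div 2 + n * (n + 1) div 2) = (- (1 :: complex))"
proof -
  have e: "even (n * (n + 1))" "even ((n + 2) * (n + 3))" by auto
  have "2 * ((n + 2) * (n + 3) div 2 + n * (n + 1) div 2) = (n + 2) * (n + 3) + n * (n + 1)"
    using e by (simp only: distrib_left dvd_mult_div_cancel)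
  also have "\<dots> = 2 * (n * (n + 1) + 2 * n + 3)"
    by (simp add: algebra_simps)
  finally have f: "(n + 2) * (n + 3) div 2 + n * (n + 1) div 2 = n * (n + 1) + 2 * n + 3"
    by (metis mult_cancel_left zero_neq_numeral)
  show ?thesis unfolding f using e(1) by (simp add: minus_one_power_iff)
qed

lemma sin_pi_shift: "sin (of_real pi * (a + 1)) = - sin (of_real pi * (a :: complex))"
  "sin (of_real pi * (a - 1)) = - sin (of_real pi * (a :: complex))"
  by (simp_all add: algebra_simps sin_add sin_diff flip: sin_of_real cos_of_real)

text \<open>Everything is reduced to Gamma and \<open>G\<close> at \<open>a\<close>,
  \<open>a - n - 1\<close> and \<open>n + 1\<close>. After cancellation the claim is
  \<open>- (n + 1) = (a - n - 1) - a\<close>.\<close>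

lemma Barnes_quotient_step:
  assumes "a \<notin> \<int>"
  defines "q \<equiv> \<lambda>n a. Barnes_G (of_nat n + 1) * Barnes_G (a + 1) / Barnes_G (a - of_nat n + 1)"
  shows "- (q (n + 2) a * q n a) = q (n + 1) a ^ 2 - q (n + 1) (a + 1) * q (n + 1) (a - 1)"
proof -
  define A where "A = Barnes_G a"
  define B where "B = Barnes_G (a - of_nat n - 1)"
  define N where "N = Barnes_G (of_nat n + 1)"
  have nz: "a + of_int m \<notin> \<int>\<^sub>\<le>\<^sub>0" for m
    using notin_Ints_add_of_int[OF assms(1)] nonpos_Ints_subset_Ints by blast
  have B0: "B \<noteq> 0" using Barnes_G_shift_nonzero[OF assms(1), of "- int n - 1"] by (simp add: B_def algebra_simps)
  have z: "a - of_nat n - 1 \<notin> \<int>\<^sub>\<le>\<^sub>0" "a - of_nat n \<notin> \<int>\<^sub>\<le>\<^sub>0" "a \<notin> \<int>\<^sub>\<le>\<^sub>0" "a + 1 \<notin> \<int>\<^sub>\<le>\<^sub>0"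
    using nz[of "- int n - 1"] nz[of "- int n"] nz[of 0] nz[of 1] by (simp_all add: algebra_simps)
  define g where "g = Gamma (a - of_nat n - 1)"
  have g0: "g \<noteq> 0" unfolding g_def using z(1) by (simp add: Gamma_eq_zero_iff)
  have b0: "a - of_nat n - 1 \<noteq> 0" using z(1) by auto
  have Ga: "Gamma (a + 1) = a * Gamma a" by (rule Gamma_plus1[OF z(3)])
  have gg: "Gamma (a - of_nat n) = (a - of_nat n - 1) * g"
    using Gamma_plus1[OF z(1)] by (simp add: g_def)
  have GB: "Barnes_G (a - of_nat n) = g * B" "Barnes_G (a - of_nat n + 1) = (a - of_nat n - 1) * g * (g * B)"
    using Barnes_G_plus1[OF z(1)] Barnes_G_plus1[OF z(2)] by (simp_all add: g_def B_def gg)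
  have GA: "Barnes_G (a + 1) = Gamma a * A" "Barnes_G (a + 2) = a * Gamma a * (Gamma a * A)"
    using Barnes_G_plus1[OF z(3)] Barnes_G_plus1[OF z(4)] by (simp_all add: A_def Ga add.assoc)
  have z': "of_nat n + 1 \<notin> (\<int>\<^sub>\<le>\<^sub>0 :: complex set)" "of_nat n + 2 \<notin> (\<int>\<^sub>\<le>\<^sub>0 :: complex set)"
    by (auto elim!: nonpos_Ints_cases simp: complex_eq_iff)
  have GN: "Barnes_G (of_nat n + 2) = Gamma (of_nat n + 1) * N"
    "Barnes_G (of_nat n + 3) = (of_nat n + 1) * Gamma (of_nat n + 1) * (Gamma (of_nat n + 1) * N)"
    using Barnes_G_plus1[OF z'(1)] Barnes_G_plus1[OF z'(2)] Gamma_plus1[OF z'(1)]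
    by (simp_all add: N_def add.assoc)
  have ar: "of_nat (n + 2) + 1 = (of_nat n + 3 :: complex)" "a - of_nat (n + 2) + 1 = a - of_nat n - 1"
    "of_nat (n + 1) + 1 = (of_nat n + 2 :: complex)" "a - of_nat (n + 1) + 1 = a - of_nat n"
    "a + 1 - of_nat (n + 1) + 1 = a - of_nat n + 1" "a + 1 + 1 = a + 2" "a - 1 + 1 = a"
    "a - 1 - of_nat (n + 1) + 1 = a - of_nat n - 1" by simp_all
  have q: "q n a = N * (Gamma a * A) / ((a - of_nat n - 1) * g * (g * B))"
    "q (n + 2) a = (of_nat n + 1) * Gamma (of_nat n + 1) * (Gamma (of_nat n + 1) * N) * (Gamma a * A) / B"
    "q (n + 1) a = Gamma (of_nat n + 1) * N * (Gamma a * A) / (g * B)"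
    "q (n + 1) (a + 1) = Gamma (of_nat n + 1) * N * (a * Gamma a * (Gamma a * A)) / ((a - of_nat n - 1) * g * (g * B))"
    "q (n + 1) (a - 1) = Gamma (of_nat n + 1) * N * A / B"
    unfolding q_def ar GA GB GN A_def[symmetric] B_def[symmetric] N_def[symmetric] by simp_all
  show ?thesis
    unfolding q using B0 g0 b0 by (simp add: divide_simps) (simp add: algebra_simps power2_eq_square)
qed

text \<open>This restores signs and sine powers. The sine changes sign when \<open>a\<close> moves
  by 1, so \<open>- S\<close> occurs in two factors with equal exponents and its sign
  cancels.\<close>

lemma signed_recurrence:
  fixes S e0 e1 e2 x0 x1 x2 xp xm :: complex
  assumes "e2 * e0 = - 1" "e1 * e1 = 1" and x: "- (x2 * x0) = x1 ^ 2 - xp * xm"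
  shows "(e2 * S ^ (n + 2) * x2) * (e0 * S ^ n * x0) =
    (e1 * S ^ (n + 1) * x1) ^ 2 - (e1 * (- S) ^ (n + 1) * xp) * (e1 * (- S) ^ (n + 1) * xm)"
proof -
  have s: "(- S) ^ (n + 1) * (- S) ^ (n + 1) = S ^ (n + 1) * S ^ (n + 1)"
    unfolding power_mult_distrib[symmetric] by simp
  have "(e2 * S ^ (n + 2) * x2) * (e0 * S ^ n * x0) = (e2 * e0) * (S ^ (n + 1) * S ^ (n + 1)) * (x2 * x0)"
    by (simp add: mult_ac)
  also have "\<dots> = (e1 * e1) * (S ^ (n + 1) * S ^ (n + 1)) * x1 ^ 2 - (e1 * e1) * (S ^ (n + 1) * S ^ (n + 1)) * (xp * xm)"
    unfolding assms using x by (simp add: algebra_simps)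
  also have "\<dots> = (e1 * S ^ (n + 1) * x1) ^ 2 - (e1 * (- S) ^ (n + 1) * xp) * (e1 * (- S) ^ (n + 1) * xm)"
  proof -
    have *: "(e * t * x) * (e * t * y) = (e * e) * (t * t) * (x * y)" for e t x y :: complex by simp
    show ?thesis unfolding power2_eq_square * s ..
  qed
  finally show ?thesis .
qed

lemma det_coeff_rec_0:
  assumes a: "a \<notin> \<int>"
  shows "det_coeff (n + 2) 0 a * det_coeff n 0 a =
    det_coeff (n + 1) 0 a ^ 2 - det_coeff (n + 1) 0 (a + 1) * det_coeff (n + 1) 0 (a - 1)"
proof -
  have a1: "a + 1 \<notin> \<int>" "a - 1 \<notin> \<int>"
    using notin_Ints_add_of_int[OF a, of 1] notin_Ints_add_of_int[OF a, of "-1"] by simp_all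
  have sgn: "((-1) ^ ((n + 2) * (n + 2 + 1) div 2 + (n + 2)) * (-1) ^ (n * (n + 1) div 2 + n) :: complex) = - 1"
  proof -
    have "(n + 2) * (n + 2 + 1) div 2 + (n + 2) + (n * (n + 1) div 2 + n) =
        (n + 2) * (n + 3) div 2 + n * (n + 1) div 2 + 2 * (n + 1)" by (simp add: numeral_3_eq_3)
    thus ?thesis
      unfolding power_add[symmetric] by (simp only: power_add[of _ _ "2 * (n + 1)"] triangular_sign_step) simp
  qed
  show ?thesis
    unfolding det_coeff_0[OF a] det_coeff_0[OF a1(1)] det_coeff_0[OF a1(2)] sin_pi_shift minus_divide_left[symmetric]
    by (rule signed_recurrence[OF sgn _ Barnes_quotient_step[OF a]]) (simp flip: power_add)
qed

text \<open>Reflection \<open>a \<mapsto> - a\<close> reduces this to the other extreme index,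
  exchanging the shifts by \<open>1\<close> and \<open>- 1\<close>.\<close>

lemma det_coeff_rec_self:
  assumes a: "a \<notin> \<int>"
  shows "det_coeff (n + 2) (n + 2) a * det_coeff n n a =
    det_coeff (n + 1) (n + 1) a ^ 2 - det_coeff (n + 1) (n + 1) (a + 1) * det_coeff (n + 1) (n + 1) (a - 1)"
proof -
  have a1: "a + 1 \<notin> \<int>" "a - 1 \<notin> \<int>" "- a \<notin> \<int>"
    using notin_Ints_add_of_int[OF a, of 1] notin_Ints_add_of_int[OF a, of "-1"] a Ints_minus[of "- a"] by auto
  have sgn: "((-1) ^ ((n + 2) * (n + 2 + 1) div 2) * (-1) ^ (n * (n + 1) div 2) :: complex) = - 1"
    using triangular_sign_step[of n] by (simp add: power_add numeral_3_eq_3)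
  have e: "- (a + 1) = - a - 1" "- (a - 1) = - a + 1" by simp_all
  show ?thesis
    unfolding det_coeff_self[OF a] det_coeff_self[OF a1(1)] det_coeff_self[OF a1(2)] sin_pi_shift
      minus_divide_left[symmetric] e
    by (rule signed_recurrence[OF sgn]) (simp flip: power_add, use Barnes_quotient_step[OF a1(3), of n] in \<open>simp only: mult.commute\<close>)
qed

text \<open>The same Barnes values occur on both sides, so only signs are at stake; both are
  \<open>- ((-1) ^ n)\<close>. The minus of the condensation identity is compensated in the
  application by the odd total power of \<open>- w\<close>.\<close>

lemma det_coeff_rec_mid:
  "det_coeff (n + 2) (i + 1) a * det_coeff n i a =
     det_coeff (n + 1) i (a + 1) * det_coeff (n + 1) (i + 1) (a - 1)"
proof -
  define S where "S = sin (of_real pi * a) / of_real pi"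
  have sgn: "((-1) ^ ((n + 2) * (n + 2 + 1) div 2 + (i + 1) * (n + 2) + (n + 2)) *
      (-1) ^ (n * (n + 1) div 2 + i * n + n) :: complex) =
      (-1) ^ ((n + 1) * (n + 1 + 1) div 2 + i * (n + 1) + (n + 1)) *
      (-1) ^ ((n + 1) * (n + 1 + 1) div 2 + (i + 1) * (n + 1) + (n + 1))"
  proof -
    have red: "(-1 :: complex) ^ (2 * k + n) = (-1) ^ n" for k by (simp add: power_add power_mult)
    have n3: "n + 2 + 1 = n + 3" by simp
    have "p + (i + 1) * (n + 2) + (n + 2) + (q + i * n + n) = p + q + (2 * (i * n + i + n + 2) + n)" for p q
      by (simp add: algebra_simps)
    hence "(n + 2) * (n + 2 + 1) div 2 + (i + 1) * (n + 2) + (n + 2) + (n * (n + 1) div 2 + i * n + n) =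
      (n + 2) * (n + 3) div 2 + n * (n + 1) div 2 + (2 * (i * n + i + n + 2) + n)"
      unfolding n3 .
    hence s1: "(-1 :: complex) ^ ((n + 2) * (n + 2 + 1) div 2 + (i + 1) * (n + 2) + (n + 2) + (n * (n + 1) div 2 + i * n + n)) =
        - ((-1) ^ n)"
      by (simp only: power_add[of _ _ "2 * (i * n + i + n + 2) + n"] triangular_sign_step red) simp
    have "p + i * (n + 1) + (n + 1) + (p + (i + 1) * (n + 1) + (n + 1)) =
      2 * (p + i * (n + 1) + (n + 1)) + (n + 1)" for p by (simp add: algebra_simps)
    note * = this[of "(n + 1) * (n + 1 + 1) div 2"]
    have s2: "(-1 :: complex) ^ ((n + 1) * (n + 1 + 1) div 2 + i * (n + 1) + (n + 1) +
        ((n + 1) * (n + 1 + 1) div 2 + (i + 1) * (n + 1) + (n + 1))) = - ((-1) ^ n)"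
    proof -
      have "(-1 :: complex) ^ (2 * k + (n + 1)) = - ((-1) ^ n)" for k by (simp add: power_add power_mult)
      thus ?thesis using * by (simp only:)
    qed
    show ?thesis using s1 s2 by (simp only: power_add[symmetric])
  qed
  have args: "of_nat (n + 2) - of_nat (i + 1) + 1 = (of_nat n - of_nat i + 2 :: complex)"
    "- a + of_nat (n + 2) - of_nat (i + 1) + 1 = - a + of_nat n - of_nat i + 2"
    "of_nat (i + 1) + 1 = (of_nat i + 2 :: complex)" "of_nat (i + 1) + a + 1 = of_nat i + a + 2"
    "- a + of_nat (n + 2) - 2 * of_nat (i + 1) + 1 = - a + of_nat n - 2 * of_nat i + 1"
    "a - of_nat (n + 2) + 2 * of_nat (i + 1) + 1 = a - of_nat n + 2 * of_nat i + 1"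
    "of_nat (n + 1) - of_nat i + 1 = (of_nat n - of_nat i + 2 :: complex)"
    "- (a + 1) + of_nat (n + 1) - of_nat i + 1 = - a + of_nat n - of_nat i + 1"
    "of_nat i + (a + 1) + 1 = of_nat i + a + 2"
    "- (a + 1) + of_nat (n + 1) - 2 * of_nat i + 1 = - a + of_nat n - 2 * of_nat i + 1"
    "a + 1 - of_nat (n + 1) + 2 * of_nat i + 1 = a - of_nat n + 2 * of_nat i + 1"
    "of_nat (n + 1) - of_nat (i + 1) + 1 = (of_nat n - of_nat i + 1 :: complex)"
    "- (a - 1) + of_nat (n + 1) - of_nat (i + 1) + 1 = - a + of_nat n - of_nat i + 2"
    "of_nat (i + 1) + (a - 1) + 1 = of_nat i + a + 1"
    "- (a - 1) + of_nat (n + 1) - 2 * of_nat (i + 1) + 1 = - a + of_nat n - 2 * of_nat i + 1"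
    "a - 1 - of_nat (n + 1) + 2 * of_nat (i + 1) + 1 = a - of_nat n + 2 * of_nat i + 1"
    by simp_all
  have SS: "S ^ (n + 2) * S ^ n = (- S) ^ (n + 1) * (- S) ^ (n + 1)"
    unfolding power_mult_distrib[symmetric] by (simp add: power_add power2_eq_square power_mult_distrib)
  have rearr: "(e * s * g) * (e' * s' * g') = (e * e') * (s * s') * (g * g')" for e s g e' s' g' :: complex
    by simp
  show ?thesis
    unfolding det_coeff_def args sin_pi_shift minus_divide_left[symmetric] S_def[symmetric] rearr sgn SS
    by (simp only: times_divide_times_eq mult_ac)
qed

section \<open>The induction on the order of the determinant\<close>

lemma det_coeff_0_0: "a \<notin> \<int> \<Longrightarrow> det_coeff 0 0 a = 1"
  using Barnes_G_shift_nonzero[of a 1] by (simp add: det_coeff_0)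

lemma Barnes_G_2: "Barnes_G 2 = 1"
  using Barnes_G_plus1[of 1] by simp

text \<open>Base case: reflection removes the sine and leaves the limit at 0 of the Bessel series of
  order \<open>- a\<close>.\<close>

lemma det_coeff_1_0:
  assumes "a \<notin> \<int>"
  shows "det_coeff 1 0 a = rGamma (1 - a)"
proof -
  have a: "a \<notin> \<int>\<^sub>\<le>\<^sub>0" using assms nonpos_Ints_subset_Ints by blast
  have "det_coeff 1 0 a = sin (of_real pi * a) / of_real pi * (Barnes_G (a + 1) / Barnes_G a)"
    unfolding det_coeff_0[OF assms] by (simp add: Barnes_G_2)
  also have "Barnes_G (a + 1) / Barnes_G a = Gamma a"
    using Barnes_G_plus1[OF a] Barnes_G_nonzero[OF a] by simp
  also have "sin (of_real pi * a) / of_real pi = rGamma a * rGamma (1 - a)"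
    by (rule rGamma_reflection_complex[symmetric])
  finally show ?thesis using a by (simp add: Gamma_def rGamma_eq_zero_iff)
qed

lemma det_coeff_1_1:
  assumes "a \<notin> \<int>"
  shows "det_coeff 1 1 a = rGamma (1 + a)"
proof -
  have "- a \<notin> \<int>" using assms Ints_minus[of "- a"] by auto
  hence a: "- a \<notin> \<int>\<^sub>\<le>\<^sub>0" using nonpos_Ints_subset_Ints by blast
  have "det_coeff 1 1 a = - (sin (of_real pi * a) / of_real pi) * (Barnes_G (- a + 1) / Barnes_G (- a))"
    unfolding det_coeff_self[OF assms] by (simp add: Barnes_G_2)
  also have "Barnes_G (- a + 1) / Barnes_G (- a) = Gamma (- a)"
    using Barnes_G_plus1[OF a] Barnes_G_nonzero[OF a] by simp
  also have "- (sin (of_real pi * a) / of_real pi) = rGamma (- a) * rGamma (1 + a)"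
    using rGamma_reflection_complex[of "- a"] by simp
  finally show ?thesis using a by (simp add: Gamma_def rGamma_eq_zero_iff)
qed

lemma weighted_det_1:
  "weighted_det (Suc 0) a \<sigma> w y = w * y powi \<sigma> * bessel_series a y + bessel_series (- a) y"
  by (simp add: weighted_det_def bessel_det_def toeplitz_symbol_def)

lemma power_int_at_0:
  assumes "k > 0"
  shows "((\<lambda>y :: complex. y powi k) \<longlongrightarrow> 0) (at 0)"
proof -
  have "((\<lambda>y :: complex. y ^ nat k) \<longlongrightarrow> 0 ^ nat k) (at 0)" by (intro tendsto_intros)
  thus ?thesis using assms by (simp add: power_int_def zero_power)
qed

lemma weighted_det_1_leading_term:
  assumes a: "a \<notin> \<int>" and d: "dominant 1 j \<sigma>" "odd \<sigma>"
  shows "has_leading_term 1 j a \<sigma> w (w ^ j * det_coeff 1 j a)"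
proof -
  have "j = 0 \<or> j = 1" using d by (auto simp: dominant_def)
  thus ?thesis
  proof
    assume j: "j = 0"
    hence "\<sigma> > 0" using d by (auto simp: dominant_def)
    hence "((\<lambda>y. w * y powi \<sigma> * bessel_series a y + bessel_series (- a) y) \<longlongrightarrow>
        w * 0 * rGamma (a + 1) + rGamma (- a + 1)) (at 0)"
      by (intro tendsto_intros bessel_series_at_0 power_int_at_0)
    thus ?thesis using det_coeff_1_0[OF a]
      by (simp add: has_leading_term_def weighted_det_1 leading_exponent_def j)
  next
    assume j: "j = 1"
    hence "\<sigma> < 0" using d by (auto simp: dominant_def)
    hence "((\<lambda>y. w * bessel_series a y + y powi (- \<sigma>) * bessel_series (- a) y) \<longlongrightarrow>
        w * rGamma (a + 1) + 0 * rGamma (- a + 1)) (at 0)"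
      by (intro tendsto_intros bessel_series_at_0 power_int_at_0) simp
    moreover have "\<forall>\<^sub>F y in at 0. w * bessel_series a y + y powi (- \<sigma>) * bessel_series (- a) y =
        (w * y powi \<sigma> * bessel_series a y + bessel_series (- a) y) * y powi (- \<sigma>)"
      using eventually_neq_at_within[of 0 0 UNIV]
      by eventually_elim (simp add: algebra_simps power_int_minus)
    ultimately have "((\<lambda>y. (w * y powi \<sigma> * bessel_series a y + bessel_series (- a) y) * y powi (- \<sigma>)) \<longlongrightarrow>
        w * rGamma (a + 1) + 0 * rGamma (- a + 1)) (at 0)"
      by (rule Lim_transform_eventually)
    thus ?thesis using det_coeff_1_1[OF a]
      by (simp add: has_leading_term_def weighted_det_1 leading_exponent_def j add.commute)
  qed
qed

lemma weighted_det_leading_term: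
  assumes "a \<notin> \<int>" "odd \<sigma>" "dominant n j \<sigma>" "w \<noteq> 0"
  shows "has_leading_term n j a \<sigma> w (w ^ j * det_coeff n j a)"
  using assms
proof (induction n arbitrary: a \<sigma> w j rule: induct_nat_012)
  case 0
  thus ?case
    by (simp add: dominant_def has_leading_term_def weighted_det_def bessel_det_def leading_exponent_def det_coeff_0_0)
next
  case 1
  thus ?case using weighted_det_1_leading_term[of a j \<sigma> w] by simp
next
  case (ge2 n)
  note a = \<open>a \<notin> \<int>\<close>
  have a1: "a + 1 \<notin> \<int>" "a - 1 \<notin> \<int>"
    using notin_Ints_add_of_int[OF a, of 1] notin_Ints_add_of_int[OF a, of "-1"] by simp_all
  have odd: "odd (\<sigma> + 2)" "odd (\<sigma> - 2)" using \<open>odd \<sigma>\<close> by simp_all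
  have w: "w \<noteq> 0" "- w \<noteq> 0" using \<open>w \<noteq> 0\<close> by simp_all
  note IH0 = ge2.IH(1)[OF a \<open>odd \<sigma>\<close> _ w(1)]
  note IH1 = ge2.IH(2)[OF a \<open>odd \<sigma>\<close> _ w(1), unfolded Suc_eq_plus1]
  note IHp = ge2.IH(2)[OF a1(1) odd(1) _ w(2), unfolded Suc_eq_plus1]
  note IHm = ge2.IH(2)[OF a1(2) odd(2) _ w(2), unfolded Suc_eq_plus1]
  have dom: "dominant (n + 2) j \<sigma>" using ge2.prems(3) by simp
  consider "j = 0" | "j = n + 2" | i where "j = i + 1" "i \<le> n"
    using dom unfolding dominant_def by (cases j) (force, force)
  hence "has_leading_term (n + 2) j a \<sigma> w (w ^ j * det_coeff (n + 2) j a)"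
  proof cases
    case j: 1
    \<comment> \<open>Exactly what keeps index 0 dominant for order \<open>n + 1\<close> and
      \<open>\<sigma> - 2\<close>, the most demanding of the four uses.\<close>
    have s: "\<sigma> > 2 * int n + 2" using dom j by (simp add: dominant_def)
    have nz: "det_coeff n 0 a \<noteq> 0" by (rule det_coeff_nonzero[OF a]) simp
    have "has_leading_term (n + 2) 0 a \<sigma> w
       (((w ^ 0 * det_coeff (n + 1) 0 a) ^ 2 * 0 ^ 0 - ((- w) ^ 0 * det_coeff (n + 1) 0 (a + 1)) *
         ((- w) ^ 0 * det_coeff (n + 1) 0 (a - 1))) / (w ^ 0 * det_coeff n 0 a))"
      by (rule has_leading_term_condensation[OF IH0 _ IH1 IHp IHm])
         (use s \<open>odd \<sigma>\<close> nz in \<open>auto simp: dominant_def leading_exponent_def\<close>)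
    also have "((w ^ 0 * det_coeff (n + 1) 0 a) ^ 2 * 0 ^ 0 - ((- w) ^ 0 * det_coeff (n + 1) 0 (a + 1)) *
         ((- w) ^ 0 * det_coeff (n + 1) 0 (a - 1))) / (w ^ 0 * det_coeff n 0 a) = det_coeff (n + 2) 0 a"
      using nz by (simp only: power_0 mult_1_left mult_1_right det_coeff_rec_0[OF a, symmetric]) simp
    finally show ?thesis by (simp add: j)
  next
    case j: 2
    have s: "\<sigma> < - 2 * int n - 2" using dom j by (simp add: dominant_def)
    have nz: "det_coeff n n a \<noteq> 0" by (rule det_coeff_nonzero[OF a]) simp
    have "has_leading_term (n + 2) (n + 2) a \<sigma> w
       (((w ^ (n + 1) * det_coeff (n + 1) (n + 1) a) ^ 2 * 0 ^ 0 - ((- w) ^ (n + 1) * det_coeff (n + 1) (n + 1) (a + 1)) *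
         ((- w) ^ (n + 1) * det_coeff (n + 1) (n + 1) (a - 1))) / (w ^ n * det_coeff n n a))"
      by (rule has_leading_term_condensation[OF IH0 _ IH1 IHp IHm])
         (use s \<open>odd \<sigma>\<close> nz w in \<open>auto simp: dominant_def leading_exponent_def algebra_simps\<close>)
    also have "((w ^ (n + 1) * det_coeff (n + 1) (n + 1) a) ^ 2 * 0 ^ 0 - ((- w) ^ (n + 1) * det_coeff (n + 1) (n + 1) (a + 1)) *
         ((- w) ^ (n + 1) * det_coeff (n + 1) (n + 1) (a - 1))) / (w ^ n * det_coeff n n a) =
         w ^ (n + 2) * det_coeff (n + 2) (n + 2) a"
    proof -
      have sq: "(- w) ^ (n + 1) * (- w) ^ (n + 1) = w ^ (n + 1) * w ^ (n + 1)"
        unfolding power_mult_distrib[symmetric] by simp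
      have "(x * u) ^ 2 * 0 ^ 0 - (x' * v) * (x' * v') = (x * x) * (u ^ 2 - v * v')" if "x' * x' = x * x"
        for x x' u v v' :: complex
      proof -
        have "(x' * v) * (x' * v') = (x' * x') * (v * v')" by simp
        thus ?thesis by (simp add: that power2_eq_square algebra_simps)
      qed
      note * = this[OF sq]
      show ?thesis
        unfolding * det_coeff_rec_self[OF a, symmetric] using nz w by (simp add: power_add field_simps)
    qed
    finally show ?thesis by (simp add: j)
  next
    case (3 i)
    note j = \<open>j = i + 1\<close>
    \<comment> \<open>Call this quantity \<open>t\<close>. Its range makes \<open>i\<close> dominant
      at order \<open>n\<close>, and at order \<open>n + 1\<close> it makes \<open>i\<close>
      dominant for \<open>\<sigma> + 2\<close> and \<open>i + 1\<close> for
      \<open>\<sigma> - 2\<close>.\<close>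
    have s: "\<sigma> - 2 * (int n + 1) + 4 * (int i + 1) > 0" "\<sigma> - 2 * (int n + 1) + 4 * (int i + 1) < 4"
      using dom j \<open>i \<le> n\<close> by (auto simp: dominant_def)
    have nz: "det_coeff n i a \<noteq> 0" by (rule det_coeff_nonzero[OF a \<open>i \<le> n\<close>])
    have "\<exists>m. \<sigma> = 2 * m + 1" using \<open>odd \<sigma>\<close> by (auto elim: oddE)
    \<comment> \<open>Oddness leaves \<open>t = 1\<close> or \<open>t = 3\<close>;
      \<open>t = 2\<close> would be a tie at order \<open>n + 1\<close>. The dominant index there is
      \<open>i + 1\<close> or \<open>i\<close> respectively, and in both cases the square has one
      surplus power of \<open>y\<close>.\<close>
    hence "\<sigma> = 2 * (int n + 1) - 4 * (int i + 1) + 1 \<or> \<sigma> = 2 * (int n + 1) - 4 * (int i + 1) + 3"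
      using s by presburger
    hence "\<exists>j1. dominant (n + 1) j1 \<sigma> \<and> 2 * leading_exponent (n + 1) j1 \<sigma> =
       leading_exponent (n + 2) (i + 1) \<sigma> + leading_exponent n i \<sigma> + int 1"
    proof
      assume *: "\<sigma> = 2 * (int n + 1) - 4 * (int i + 1) + 1"
      show ?thesis
        by (rule exI[of _ "i + 1"]) (use \<open>i \<le> n\<close> in \<open>auto simp: dominant_def leading_exponent_def * algebra_simps\<close>)
    next
      assume *: "\<sigma> = 2 * (int n + 1) - 4 * (int i + 1) + 3"
      show ?thesis
        by (rule exI[of _ i]) (use \<open>i \<le> n\<close> in \<open>auto simp: dominant_def leading_exponent_def * algebra_simps\<close>)
    qed
    then obtain j1 where j1: "dominant (n + 1) j1 \<sigma>"
      "2 * leading_exponent (n + 1) j1 \<sigma> = leading_exponent (n + 2) (i + 1) \<sigma> + leading_exponent n i \<sigma> + int 1"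
      by blast
    have "has_leading_term (n + 2) (i + 1) a \<sigma> w
       (((w ^ j1 * det_coeff (n + 1) j1 a) ^ 2 * 0 ^ 1 - ((- w) ^ i * det_coeff (n + 1) i (a + 1)) *
         ((- w) ^ (i + 1) * det_coeff (n + 1) (i + 1) (a - 1))) / (w ^ i * det_coeff n i a))"
      by (rule has_leading_term_condensation[OF IH0 _ IH1 IHp IHm _ j1(2)])
         (use s j1(1) \<open>i \<le> n\<close> nz w in \<open>auto simp: dominant_def leading_exponent_def algebra_simps\<close>)
    also have "((w ^ j1 * det_coeff (n + 1) j1 a) ^ 2 * 0 ^ 1 - ((- w) ^ i * det_coeff (n + 1) i (a + 1)) *
         ((- w) ^ (i + 1) * det_coeff (n + 1) (i + 1) (a - 1))) / (w ^ i * det_coeff n i a) =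
         w ^ (i + 1) * det_coeff (n + 2) (i + 1) a"
    proof -
      have sq: "(- w) ^ i * (- w) ^ i = w ^ i * w ^ i"
        unfolding power_mult_distrib[symmetric] by simp
      have *: "z ^ 2 * 0 ^ 1 - ((- w) ^ i * v) * ((- w) ^ (i + 1) * v') = w * ((- w) ^ i * (- w) ^ i) * (v * v')"
        for v v' z :: complex by simp
      show ?thesis unfolding * sq det_coeff_rec_mid[symmetric] using nz w by (simp add: field_simps)
    qed
    finally show ?thesis by (simp add: j)
  qed
  thus ?case by simp
qed

section \<open>Asymptotics of the determinants\<close>

text \<open>By Lagrange interpolation at \<open>n + 1\<close> points, a coefficient is a fixed
  linear combination of values, the degree bound being uniform in \<open>y\<close>. The nodes start
  at 1 because convergence is assumed only for \<open>w \<noteq> 0\<close>.\<close>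

lemma coeff_tendsto:
  fixes p :: "'b \<Rightarrow> complex poly"
  assumes deg: "\<And>y. degree (p y) \<le> n" "degree q \<le> n"
    and lim: "\<And>w. w \<noteq> 0 \<Longrightarrow> ((\<lambda>y. poly (p y) w) \<longlongrightarrow> poly q w) F"
  shows "((\<lambda>y. coeff (p y) i) \<longlongrightarrow> coeff q i) F"
proof -
  define I where "I = {1..n + 1}"
  define L :: "nat \<Rightarrow> complex poly" where
    "L = (\<lambda>k. Polynomial.smult (1 / (\<Prod>l\<in>I - {k}. of_nat k - of_nat l)) (\<Prod>l\<in>I - {k}. [:- of_nat l, 1:]))"
  have deg_L: "degree (L k) \<le> n" if "k \<in> I" for k
  proof -
    have "degree (\<Prod>l\<in>I - {k}. [:- of_nat l, 1 :: complex:]) \<le> (\<Sum>l\<in>I - {k}. degree [:- of_nat l, 1 :: complex:])"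
      by (rule degree_prod_sum_le[unfolded o_def]) (simp add: I_def)
    also have "\<dots> = n" using that by (simp add: I_def)
    finally show ?thesis unfolding L_def using degree_smult_le le_trans by blast
  qed
  have L: "poly (L k) (of_nat m) = (if m = k then 1 else 0)" if "k \<in> I" "m \<in> I" for k m
    using that by (auto simp: L_def poly_prod I_def)
  have lagrange: "P = (\<Sum>k\<in>I. Polynomial.smult (poly P (of_nat k)) (L k))" if "degree P \<le> n" for P
  proof (rule poly_eqI_degree[where A = "of_nat ` I"])
    fix x :: complex assume "x \<in> of_nat ` I"
    then obtain m where m: "m \<in> I" "x = of_nat m" by blast
    have "poly (\<Sum>k\<in>I. Polynomial.smult (poly P (of_nat k)) (L k)) x = (\<Sum>k\<in>I. if k = m then poly P x else 0)"
      unfolding poly_sum by (rule sum.cong) (use m L in auto)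
    thus "poly P x = poly (\<Sum>k\<in>I. Polynomial.smult (poly P (of_nat k)) (L k)) x" using m by (simp add: I_def)
  next
    have c: "card (of_nat ` I :: complex set) = n + 1"
      by (subst card_image) (auto simp: I_def inj_on_def)
    show "degree P < card (of_nat ` I :: complex set)" using that c by simp
    have "degree (\<Sum>k\<in>I. Polynomial.smult (poly P (of_nat k)) (L k)) \<le> n"
    proof (rule degree_sum_le)
      fix k assume "k \<in> I"
      thus "degree (Polynomial.smult (poly P (of_nat k)) (L k)) \<le> n"
        using deg_L degree_smult_le le_trans by blast
    qed (simp add: I_def)
    thus "degree (\<Sum>k\<in>I. Polynomial.smult (poly P (of_nat k)) (L k)) < card (of_nat ` I :: complex set)" using c by simp
  qed
  have coeff: "coeff P i = (\<Sum>k\<in>I. poly P (of_nat k) * coeff (L k) i)" if "degree P \<le> n" for P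
    by (subst lagrange[OF that]) (simp add: coeff_sum)
  show ?thesis
    unfolding coeff[OF deg(1)] coeff[OF deg(2)]
    by (intro tendsto_sum tendsto_mult tendsto_const lim) (auto simp: I_def)
qed

text \<open>The polynomial variable is \<open>U\<close>, with \<open>V = 1\<close>; by homogeneity
  the coefficients are the \<open>F_j\<close>.\<close>

definition bessel_det_poly :: "nat \<Rightarrow> complex \<Rightarrow> complex \<Rightarrow> complex poly" where
  "bessel_det_poly n a y = toeplitz_det n (\<lambda>m.
     [:(-1) powi m * y powi (-m) * bessel_series (- a - of_int m) y, y powi m * bessel_series (a + of_int m) y:])"

lemma poly_toeplitz_det: "poly (toeplitz_det n e) x = toeplitz_det n (\<lambda>m. poly (e m) x)" for x :: complex
  by (rule comm_ring_hom.hom_toeplitz_det) (unfold_locales, auto)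

lemma poly_bessel_det_poly: "poly (bessel_det_poly n a y) U = bessel_det n a U 1 y"
  by (simp add: bessel_det_poly_def poly_toeplitz_det bessel_det_def toeplitz_symbol_def[abs_def] algebra_simps)

lemma degree_bessel_det_poly: "degree (bessel_det_poly n a y) \<le> n"
proof -
  have "degree (bessel_det_poly n a y) \<le> 1 * n"
    unfolding bessel_det_poly_def toeplitz_det_def by (rule degree_det_le) auto
  thus ?thesis by simp
qed

text \<open>For \<open>V \<noteq> 0\<close> this is homogeneity. The value \<open>V = 0\<close>,
  which arises from \<open>d2 = 0\<close>, follows by continuity, as both sides are polynomials in
  \<open>V\<close>.\<close>

lemma bessel_det_expansion:
  "bessel_det n a U V y = (\<Sum>i\<le>n. coeff (bessel_det_poly n a y) i * U ^ i * V ^ (n - i))"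
proof -
  have nz: "bessel_det n a U V y = (\<Sum>i\<le>n. coeff (bessel_det_poly n a y) i * U ^ i * V ^ (n - i))"
    if "V \<noteq> 0" for V
  proof -
    have "bessel_det n a U V y = bessel_det n a (V * (U / V)) (V * 1) y" using that by simp
    also have "\<dots> = V ^ n * poly (bessel_det_poly n a y) (U / V)"
      unfolding bessel_det_scale poly_bessel_det_poly ..
    also have "poly (bessel_det_poly n a y) (U / V) = (\<Sum>i\<le>n. coeff (bessel_det_poly n a y) i * (U / V) ^ i)"
      unfolding poly_altdef
      by (rule sum.mono_neutral_left) (use degree_bessel_det_poly[of n a y] in \<open>auto simp: coeff_eq_0\<close>)
    finally show ?thesis
      using that by (simp add: sum_distrib_left power_divide power_diff mult_ac)
  qed
  show ?thesis
  proof (cases "V = 0")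
    case True
    define p where "p = toeplitz_det n (\<lambda>m. [:U * y powi m * bessel_series (a + of_int m) y,
        (-1) powi m * y powi (-m) * bessel_series (- a - of_int m) y:])"
    have p: "bessel_det n a U V y = poly p V" for V
      by (simp add: p_def poly_toeplitz_det bessel_det_def toeplitz_symbol_def[abs_def] algebra_simps)
    have "((\<lambda>V. poly p V) \<longlongrightarrow> poly p 0) (at 0)" by (intro tendsto_intros)
    moreover have "\<forall>\<^sub>F V in at 0. poly p V = (\<Sum>i\<le>n. coeff (bessel_det_poly n a y) i * U ^ i * V ^ (n - i))"
      using eventually_neq_at_within[of 0 0 UNIV] unfolding p[symmetric] by eventually_elim (rule nz)
    ultimately have "((\<lambda>V. \<Sum>i\<le>n. coeff (bessel_det_poly n a y) i * U ^ i * V ^ (n - i)) \<longlongrightarrow> poly p 0) (at 0)"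
      by (rule Lim_transform_eventually)
    moreover have "((\<lambda>V. \<Sum>i\<le>n. coeff (bessel_det_poly n a y) i * U ^ i * V ^ (n - i)) \<longlongrightarrow>
        (\<Sum>i\<le>n. coeff (bessel_det_poly n a y) i * U ^ i * 0 ^ (n - i))) (at 0)" by (intro tendsto_intros)
    ultimately show ?thesis unfolding p True by (rule tendsto_unique[rotated]) simp
  qed (rule nz)
qed

text \<open>As polynomials in \<open>w\<close>, the rescaled determinants converge to a single
  monomial at every nonzero \<open>w\<close>, and its coefficient is read off by
  interpolation.\<close>

lemma bessel_det_poly_coeff_asymp:
  assumes a: "a \<notin> \<int>" and j: "j \<le> n"
  shows "((\<lambda>y. coeff (bessel_det_poly n a y) j * y ^ (2 * j * (n - j))) \<longlongrightarrow> det_coeff n j a) (at 0)"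
proof -
  \<comment> \<open>This odd choice gives \<open>s - 2 n + 4 j = 1\<close>, within the range where
    \<open>j\<close> is dominant.\<close>
  define s where "s = 2 * int n - 4 * int j + 1"
  define e where "e = leading_exponent n j s"
  define p where "p = (\<lambda>y. Polynomial.smult (y powi (- e)) (pcompose (bessel_det_poly n a y) [:0, y powi s:]))"
  have deg: "degree (p y) \<le> n" for y
  proof -
    have "degree (pcompose (bessel_det_poly n a y) [:0, y powi s:]) \<le> degree (bessel_det_poly n a y) * degree [:0, y powi s:]"
      by (rule degree_pcompose_le)
    also have "\<dots> \<le> n * 1" by (rule mult_mono) (use degree_bessel_det_poly in auto)
    finally show ?thesis unfolding p_def using degree_smult_le le_trans by fastforce
  qed
  have "((\<lambda>y. poly (p y) w) \<longlongrightarrow> poly (monom (det_coeff n j a) j) w) (at 0)" if "w \<noteq> 0" for w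
  proof -
    have "dominant n j s" using j by (auto simp: dominant_def s_def)
    from weighted_det_leading_term[OF a _ this that]
    have "has_leading_term n j a s w (w ^ j * det_coeff n j a)" by (simp add: s_def)
    thus ?thesis
      by (simp add: has_leading_term_def p_def poly_pcompose poly_bessel_det_poly weighted_det_def e_def poly_monom mult_ac)
  qed
  from coeff_tendsto[OF deg _ this, of j]
  have "((\<lambda>y. coeff (p y) j) \<longlongrightarrow> det_coeff n j a) (at 0)"
    using j by (simp add: degree_monom_eq degree_monom_le[THEN le_trans])
  moreover have "\<forall>\<^sub>F y in at 0. coeff (p y) j = coeff (bessel_det_poly n a y) j * y ^ (2 * j * (n - j))"
    using eventually_neq_at_within[of 0 0 UNIV]
  proof eventually_elim
    case (elim y)
    have "(y powi s) ^ j * y powi (- e) = y powi (s * int j + - e)"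
      unfolding power_int_add[OF disjI1[OF elim]] by (simp add: power_int_mult)
    also have "s * int j + - e = int (2 * j * (n - j))"
      using j by (simp add: e_def leading_exponent_def of_nat_diff)
    also have "y powi int (2 * j * (n - j)) = y ^ (2 * j * (n - j))" by (rule power_int_of_nat)
    finally have *: "(y powi s) ^ j * y powi (- e) = y ^ (2 * j * (n - j))" .
    show ?case
      unfolding p_def coeff_smult coeff_pcompose_linear *[symmetric] by (simp only: mult_ac)
  qed
  ultimately show ?thesis by (rule Lim_transform_eventually)
qed

text \<open>Every term of the expansion is divided by the claimed leading one. The first alternative
  in \<open>dom\<close> covers terms removed by \<open>A = 0\<close> or
  \<open>B = 0\<close>.\<close>

lemma bessel_det_asymp:
  assumes a: "a \<notin> \<int>" and j: "j \<le> n" and nz: "A ^ j * B ^ (n - j) \<noteq> 0"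
    and dom: "\<And>i. i \<le> n \<Longrightarrow> i \<noteq> j \<Longrightarrow> A ^ i * B ^ (n - i) = 0 \<or>
      (real i - real j) * (Re a - real n + real i + real j) > 0"
  shows "(\<lambda>x. bessel_det n a (A * (x / 2) powr a) (B * (x / 2) powr (- a)) (x / 2)) \<sim>[at 0 within S]
    (\<lambda>x. A ^ j * B ^ (n - j) * det_coeff n j a *
      (x / 2) powr (of_nat j * (2 * a - 2 * of_nat n + 2 * of_nat j) - of_nat n * a))" (is "?f \<sim>[_] ?g")
proof (rule asymp_equivI')
  define K where "K = A ^ j * B ^ (n - j) * det_coeff n j a"
  have K: "K \<noteq> 0" using nz det_coeff_nonzero[OF a j] by (simp add: K_def)
  \<comment> \<open>The term with index \<open>i\<close> has exponent
    \<open>a (2 i - n) - 2 i (n - i)\<close>; \<open>b i\<close> is its excess over that of index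
    \<open>j\<close>.\<close>
  define b where "b = (\<lambda>i. (of_nat i - of_nat j) * (2 * (a - of_nat n + of_nat i + of_nat j)))"
  define t where "t = (\<lambda>i y. coeff (bessel_det_poly n a y) i * y ^ (2 * i * (n - i)) *
      (A ^ i * B ^ (n - i) / K * y powr (b i)))"
  have half: "filterlim (\<lambda>x :: complex. x / 2) (at 0) (at 0 within S)"
    by (rule filterlim_atI) (auto intro!: tendsto_eq_intros simp: eventually_at_filter)
  have "(t i \<longlongrightarrow> (if i = j then 1 else 0)) (at 0)" if i: "i \<le> n" for i
  proof -
    have "((\<lambda>y. A ^ i * B ^ (n - i) / K * y powr (b i)) \<longlongrightarrow>
        (if i = j then 1 / det_coeff n j a else 0)) (at 0)"
    proof (cases "i = j")
      case True
      have "\<forall>\<^sub>F y in at 0. 1 / det_coeff n j a = A ^ i * B ^ (n - i) / K * y powr (b i)"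
        using eventually_neq_at_within[of 0 0 UNIV]
        by eventually_elim (use True nz in \<open>simp add: b_def K_def\<close>)
      from Lim_transform_eventually[OF tendsto_const this] show ?thesis using True by simp
    next
      case False
      from dom[OF i this] show ?thesis
      proof
        assume "(real i - real j) * (Re a - real n + real i + real j) > 0"
        moreover have "Re (b i) = 2 * ((real i - real j) * (Re a - real n + real i + real j))"
          by (simp add: b_def)
        ultimately have "Re (b i) > 0" by simp
        \<comment> \<open>Arguments are bounded on the principal branch, so a positive real part of
          the exponent suffices.\<close>
        from tendsto_powr_complex_0[OF tendsto_ident_at tendsto_const this, of UNIV]
        have "((\<lambda>y. A ^ i * B ^ (n - i) / K * y powr (b i)) \<longlongrightarrow> A ^ i * B ^ (n - i) / K * 0) (at 0)"
          by (intro tendsto_mult tendsto_const)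
        thus ?thesis using False by simp
      next
        assume z: "A ^ i * B ^ (n - i) = 0"
        show ?thesis using False by (simp only: z) simp
      qed
    qed
    from tendsto_mult[OF bessel_det_poly_coeff_asymp[OF a i] this]
    show ?thesis unfolding t_def using det_coeff_nonzero[OF a j] by (auto split: if_splits)
  qed
  hence "((\<lambda>y. \<Sum>i\<le>n. t i y) \<longlongrightarrow> (\<Sum>i\<le>n. if i = j then 1 else 0)) (at 0)"
    by (intro tendsto_sum) simp
  hence "((\<lambda>x. \<Sum>i\<le>n. t i (x / 2)) \<longlongrightarrow> 1) (at 0 within S)"
    using j by (intro filterlim_compose[OF _ half]) simp
  moreover have "\<forall>\<^sub>F x in at 0 within S. (\<Sum>i\<le>n. t i (x / 2)) = ?f x / ?g x"
    using eventually_neq_at_within[of 0 0 S]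
  proof eventually_elim
    case (elim x)
    define y where "y = x / 2"
    have y: "y \<noteq> 0" using elim by (simp add: y_def)
    define E where "E = of_nat j * (2 * a - 2 * of_nat n + 2 * of_nat j) - of_nat n * a"
    have "coeff (bessel_det_poly n a y) i * (A * y powr a) ^ i * (B * y powr (- a)) ^ (n - i) / (K * y powr E) = t i y"
      if i: "i \<le> n" for i
    proof -
      \<comment> \<open>Both powers use the same logarithm of \<open>y\<close>, so their complex
        exponents may be added.\<close>
      have "(y powr a) ^ i * (y powr (- a)) ^ (n - i) = y powr (of_nat i * a + of_nat (n - i) * (- a))"
        unfolding powr_power[OF y] powr_add ..
      also have "of_nat i * a + of_nat (n - i) * (- a) = of_nat (2 * i * (n - i)) + b i + E"
        using i by (simp add: b_def E_def of_nat_diff algebra_simps)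
      also have "y powr \<dots> = y ^ (2 * i * (n - i)) * y powr (b i) * y powr E"
        unfolding powr_add powr_nat'[OF disjI1[OF y]] ..
      finally have e: "(y powr a) ^ i * (y powr (- a)) ^ (n - i) = y ^ (2 * i * (n - i)) * y powr (b i) * y powr E" .
      have f: "coeff (bessel_det_poly n a y) i * (A * y powr a) ^ i * (B * y powr (- a)) ^ (n - i) =
          coeff (bessel_det_poly n a y) i * (A ^ i * B ^ (n - i)) * ((y powr a) ^ i * (y powr (- a)) ^ (n - i))"
        by (simp add: power_mult_distrib mult_ac)
      show ?thesis unfolding f e t_def using y K by simp
    qed
    hence "?f x / ?g x = (\<Sum>i\<le>n. t i y)"
      unfolding y_def[symmetric] E_def[symmetric] K_def[symmetric] bessel_det_expansion sum_divide_distrib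
      by (intro sum.cong) auto
    thus ?case by (simp add: y_def)
  qed
  ultimately show "((\<lambda>x. ?f x / ?g x) \<longlongrightarrow> 1) (at 0 within S)"
    by (rule Lim_transform_eventually)
qed

section \<open>From cylinder functions to the variables \<open>U\<close> and
  \<open>V\<close>\<close>

lemma sin_cos_shift_int:
  fixes z :: complex
  shows "sin (of_real pi * (z + of_int m)) = (-1) powi m * sin (of_real pi * z)"
    and "cos (of_real pi * (z + of_int m)) = (-1) powi m * cos (of_real pi * z)"
proof -
  have "sin (of_real pi * of_int m :: complex) = of_real (sin (pi * of_int m))"
    "cos (of_real pi * of_int m :: complex) = of_real (cos (pi * of_int m))"
    by (simp_all only: of_real_mult of_real_of_int_eq flip: sin_of_real cos_of_real)
  hence sc: "sin (of_real pi * of_int m :: complex) = 0" "cos (of_real pi * of_int m :: complex) = (-1) powi m"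
    by (simp_all add: power_int_minus_left)
  show "sin (of_real pi * (z + of_int m)) = (-1) powi m * sin (of_real pi * z)"
    and "cos (of_real pi * (z + of_int m)) = (-1) powi m * cos (of_real pi * z)"
    unfolding distrib_left sin_add cos_add sc by simp_all
qed

text \<open>All orders \<open>a + m\<close> are nonintegers, so \<open>Bessel_Y\<close> is given by
  its quotient and only \<open>Bessel_J\<close> of orders \<open>a + m\<close> and
  \<open>- a - m\<close> occurs. The sign \<open>(-1)^m\<close> of sine and cosine cancels in the
  first and remains in the second.\<close>

lemma cylinder_C_eq_toeplitz_symbol:
  assumes a: "a \<notin> \<int>" and x: "x \<noteq> 0"
  defines "s \<equiv> sin (of_real pi * a)" and "c \<equiv> cos (of_real pi * a)"
  shows "cylinder_C d1 d2 (a + of_int m) x =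
    toeplitz_symbol a ((d1 * s + d2 * c) / s * (x / 2) powr a) (- d2 / s * (x / 2) powr (- a)) (x / 2) m"
proof -
  define y where "y = x / 2"
  have y: "y \<noteq> 0" using x by (simp add: y_def)
  define \<epsilon> :: complex where "\<epsilon> = (-1) powi m"
  have \<epsilon>: "\<epsilon> \<noteq> 0" "1 / \<epsilon> = \<epsilon>" by (simp_all add: \<epsilon>_def power_int_minus_left)
  have s0: "s \<noteq> 0" unfolding s_def by (rule sin_pi_nonzero[OF a])
  have J: "Bessel_J \<nu> x = y powr \<nu> * bessel_series \<nu> y" for \<nu>
    by (simp add: Bessel_J_def bessel_series_def y_def)
  have pw: "y powr (of_int k) = y powi k" for k :: int
    using y by (simp add: powr_of_int power_int_def power_inverse)
  have p: "y powr (a + of_int m) = y powr a * y powi m"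
    "y powr (- a - of_int m) = y powr (- a) * y powi (- m)"
    using powr_add[of y a "of_int m"] powr_add[of y "- a" "of_int (- m)"] pw[of m] pw[of "- m"] by simp_all
  have nint: "a + of_int m \<notin> \<int>" by (rule notin_Ints_add_of_int[OF a])
  have "cylinder_C d1 d2 (a + of_int m) x = d1 * (y powr a * y powi m * bessel_series (a + of_int m) y) +
    d2 * ((y powr a * y powi m * bessel_series (a + of_int m) y * (\<epsilon> * c) -
       y powr (- a) * y powi (- m) * bessel_series (- (a + of_int m)) y) / (\<epsilon> * s))"
    using nint
    by (simp add: cylinder_C_def Bessel_Y_def Bessel_Y_quot_def J p mult.commute[of _ "of_real pi"]
          sin_cos_shift_int s_def c_def \<epsilon>_def)
  also have "\<dots> = (d1 * s + d2 * c) / s * y powr a * y powi m * bessel_series (a + of_int m) y +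
      (- d2 / s * y powr (- a)) * (1 / \<epsilon>) * y powi (- m) * bessel_series (- (a + of_int m)) y"
    using s0 \<epsilon>(1) by (simp add: field_simps)
  finally show ?thesis unfolding \<epsilon>(2) by (simp add: toeplitz_symbol_def y_def \<epsilon>_def)
qed

lemma Toeplitz_Delta_eq_bessel_det:
  assumes "\<alpha> / 2 \<notin> \<int>" "x \<noteq> 0"
  defines "s \<equiv> sin (of_real pi * (\<alpha> / 2))" and "c \<equiv> cos (of_real pi * (\<alpha> / 2))"
  shows "Toeplitz_Delta d1 d2 n x \<alpha> = bessel_det n (\<alpha> / 2)
    ((d1 * s + d2 * c) / s * (x / 2) powr (\<alpha> / 2)) (- d2 / s * (x / 2) powr (- (\<alpha> / 2))) (x / 2)"
proof -
  have "cylinder_C d1 d2 (\<alpha> / 2 - of_nat j + of_nat k) x = toeplitz_symbol (\<alpha> / 2)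
    ((d1 * s + d2 * c) / s * (x / 2) powr (\<alpha> / 2)) (- d2 / s * (x / 2) powr (- (\<alpha> / 2))) (x / 2) (int k - int j)" for j k
    using cylinder_C_eq_toeplitz_symbol[OF assms(1,2), of d1 d2 "int k - int j"]
    by (simp add: s_def c_def algebra_simps)
  thus ?thesis by (simp add: Toeplitz_Delta_def bessel_det_def toeplitz_det_def)
qed

lemma Toeplitz_Delta_asymp:
  assumes a: "\<alpha> / 2 \<notin> \<int>" and j: "j \<le> n"
  defines "s \<equiv> sin (of_real pi * (\<alpha> / 2))" and "c \<equiv> cos (of_real pi * (\<alpha> / 2))"
  assumes nz: "j = 0 \<or> d1 * s + d2 * c \<noteq> 0" "j = n \<or> d2 \<noteq> 0"
    and dom: "j = 0 \<or> d2 = 0 \<or> Re \<alpha> < 2 * real n - 4 * real j + 2"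
      "j = n \<or> d1 * s + d2 * c = 0 \<or> Re \<alpha> > 2 * real n - 4 * real j - 2"
  shows "(\<lambda>x. Toeplitz_Delta d1 d2 n x \<alpha>) \<sim>[at 0 within S]
    (\<lambda>x. ((d1 * s + d2 * c) / s) ^ j * (- d2 / s) ^ (n - j) * det_coeff n j (\<alpha> / 2) *
      (x / 2) powr ((\<alpha> - 2 * of_nat n + 2 * of_nat j) * of_nat j - of_nat n * \<alpha> / 2))"
proof -
  define A where "A = (d1 * s + d2 * c) / s"
  define B where "B = - d2 / s"
  have s0: "s \<noteq> 0" unfolding s_def by (rule sin_pi_nonzero[OF a])
  have "A ^ j * B ^ (n - j) \<noteq> 0" using nz s0 by (auto simp: A_def B_def)
  moreover have "A ^ i * B ^ (n - i) = 0 \<or> (real i - real j) * (Re (\<alpha> / 2) - real n + real i + real j) > 0"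
    if i: "i \<le> n" "i \<noteq> j" for i
  proof (cases "i < j")
    case True
    hence "d2 = 0 \<or> Re \<alpha> < 2 * real n - 4 * real j + 2" using dom(1) by auto
    thus ?thesis
    proof
      assume "d2 = 0"
      thus ?thesis using True j by (simp add: B_def)
    next
      assume *: "Re \<alpha> < 2 * real n - 4 * real j + 2"
      \<comment> \<open>Hence \<open>i + j \<le> 2 j - 1\<close>: the adjacent index is the worst
        case, and the bound on \<open>Re \<alpha>\<close> is the one for it.\<close>
      have "real i + 1 \<le> real j" using True by simp
      hence "Re (\<alpha> / 2) - real n + real i + real j < 0" "real i - real j < 0" using * by simp_all
      thus ?thesis by (simp add: mult_neg_neg)
    qed
  next
    case False
    hence ij: "j < i" using i by simp
    hence "d1 * s + d2 * c = 0 \<or> Re \<alpha> > 2 * real n - 4 * real j - 2" using dom(2) i by auto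
    thus ?thesis
    proof
      assume "d1 * s + d2 * c = 0"
      thus ?thesis using ij by (simp add: A_def)
    next
      assume *: "Re \<alpha> > 2 * real n - 4 * real j - 2"
      have "real j + 1 \<le> real i" using ij by simp
      hence "Re (\<alpha> / 2) - real n + real i + real j > 0" "real i - real j > 0" using * by simp_all
      thus ?thesis by simp
    qed
  qed
  ultimately have "(\<lambda>x. bessel_det n (\<alpha> / 2) (A * (x / 2) powr (\<alpha> / 2)) (B * (x / 2) powr (- (\<alpha> / 2))) (x / 2))
    \<sim>[at 0 within S] (\<lambda>x. A ^ j * B ^ (n - j) * det_coeff n j (\<alpha> / 2) *
      (x / 2) powr (of_nat j * (2 * (\<alpha> / 2) - 2 * of_nat n + 2 * of_nat j) - of_nat n * (\<alpha> / 2)))"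
    by (rule bessel_det_asymp[OF a j])
  thus ?thesis
  proof (rule asymp_equiv_transfer)
    show "\<forall>\<^sub>F x in at 0 within S. bessel_det n (\<alpha> / 2) (A * (x / 2) powr (\<alpha> / 2)) (B * (x / 2) powr (- (\<alpha> / 2))) (x / 2) =
        Toeplitz_Delta d1 d2 n x \<alpha>"
      using eventually_neq_at_within[of 0 0 S] unfolding A_def B_def s_def c_def
      by eventually_elim (rule Toeplitz_Delta_eq_bessel_det[OF a, symmetric])
  qed (simp add: A_def B_def mult.commute)
qed

theorem theorem1p1:
  fixes d1 d2 \<alpha> :: complex and n :: nat
  assumes "\<alpha> \<notin> {2 * of_int m | m :: int. True}"
  defines "s \<equiv> sin (of_real pi * \<alpha> / 2)" and "c \<equiv> cos (of_real pi * \<alpha> / 2)"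
    and "F \<equiv> at 0 within {x :: complex. - pi < Arg x \<and> Arg x < pi}"
  shows
    "(d2 \<noteq> 0 \<and> (Re \<alpha> > 2 * real n - 2 \<or> d1 * s + d2 * c = 0) \<longrightarrow>
       (\<lambda>x. Toeplitz_Delta d1 d2 n x \<alpha>) \<sim>[F]
       (\<lambda>x. (-1) ^ (n * (n + 1) div 2) * (d2 / of_real pi) ^ n *
            (Barnes_G (of_nat n + 1) * Barnes_G (\<alpha> / 2 + 1) / Barnes_G (\<alpha> / 2 - of_nat n + 1)) *
            (x / 2) powr (- (of_nat n * \<alpha> / 2))))
     \<and>
     (\<forall>j \<in> {1..n - 1}.
       d2 \<noteq> 0 \<and> d1 * s + d2 * c \<noteq> 0 \<and>
       2 * real n - 4 * real j - 2 < Re \<alpha> \<and> Re \<alpha> < 2 * real n - 4 * real j + 2 \<longrightarrow>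
       (\<lambda>x. Toeplitz_Delta d1 d2 n x \<alpha>) \<sim>[F]
       (\<lambda>x. (-1) ^ (n * (n + 1) div 2 + j * (n - 1)) * (d2 / of_real pi) ^ n *
            (d1 / d2 * s + c) ^ j *
            (Barnes_G (of_nat n - of_nat j + 1) * Barnes_G (- \<alpha> / 2 + of_nat n - of_nat j + 1) *
             Barnes_G (of_nat j + 1) * Barnes_G (of_nat j + \<alpha> / 2 + 1) /
             (Barnes_G (- \<alpha> / 2 + of_nat n - 2 * of_nat j + 1) *
              Barnes_G (\<alpha> / 2 - of_nat n + 2 * of_nat j + 1))) *
            (x / 2) powr ((\<alpha> - 2 * of_nat n + 2 * of_nat j) * of_nat j - of_nat n * \<alpha> / 2)))
     \<and>
     (d1 * s + d2 * c \<noteq> 0 \<and> (Re \<alpha> < - 2 * real n + 2 \<or> d2 = 0) \<longrightarrow>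
       (\<lambda>x. Toeplitz_Delta d1 d2 n x \<alpha>) \<sim>[F]
       (\<lambda>x. (-1) ^ (n * (n + 1) div 2) / of_real pi ^ n * (d1 * s + d2 * c) ^ n *
            (Barnes_G (of_nat n + 1) * Barnes_G (- \<alpha> / 2 + 1) / Barnes_G (- \<alpha> / 2 - of_nat n + 1)) *
            (x / 2) powr (of_nat n * \<alpha> / 2)))"
proof -
  have a: "\<alpha> / 2 \<notin> \<int>"
  proof
    assume "\<alpha> / 2 \<in> \<int>"
    then obtain m where "\<alpha> / 2 = of_int m" by (elim Ints_cases)
    hence "\<alpha> = 2 * of_int m" by (simp add: field_simps)
    with assms(1) show False by blast
  qed
  have sc: "sin (of_real pi * (\<alpha> / 2)) = s" "cos (of_real pi * (\<alpha> / 2)) = c" by (simp_all add: s_def c_def)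
  have s0: "s \<noteq> 0" using sin_pi_nonzero[OF a] unfolding sc .
  have sgn: "(-1) ^ n * (-1) ^ n = (1 :: complex)" by (simp flip: power_add)
  \<comment> \<open>The three cases of the theorem are the indices \<open>0\<close>,
    \<open>j\<close> and \<open>n\<close>; what remains is to match constants and exponents.\<close>
  note asymp = Toeplitz_Delta_asymp[OF a, where S = "{x. - pi < Arg x \<and> Arg x < pi}", folded F_def, unfolded sc]
  have "(\<lambda>x. Toeplitz_Delta d1 d2 n x \<alpha>) \<sim>[F]
       (\<lambda>x. (-1) ^ (n * (n + 1) div 2) * (d2 / of_real pi) ^ n *
            (Barnes_G (of_nat n + 1) * Barnes_G (\<alpha> / 2 + 1) / Barnes_G (\<alpha> / 2 - of_nat n + 1)) *
            (x / 2) powr (- (of_nat n * \<alpha> / 2)))"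
    if "d2 \<noteq> 0" "Re \<alpha> > 2 * real n - 2 \<or> d1 * s + d2 * c = 0"
  proof -
    have "(\<lambda>x. Toeplitz_Delta d1 d2 n x \<alpha>) \<sim>[F]
      (\<lambda>x. ((d1 * s + d2 * c) / s) ^ 0 * (- d2 / s) ^ (n - 0) * det_coeff n 0 (\<alpha> / 2) *
      (x / 2) powr ((\<alpha> - 2 * of_nat n + 2 * of_nat 0) * of_nat 0 - of_nat n * \<alpha> / 2))"
      by (rule asymp) (use that in auto)
    also have "((d1 * s + d2 * c) / s) ^ 0 * (- d2 / s) ^ (n - 0) * det_coeff n 0 (\<alpha> / 2) =
        (-1) ^ (n * (n + 1) div 2) * (d2 / of_real pi) ^ n *
            (Barnes_G (of_nat n + 1) * Barnes_G (\<alpha> / 2 + 1) / Barnes_G (\<alpha> / 2 - of_nat n + 1))"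
    proof -
      have e: "- d2 / s = (-1) * d2 / s" by simp
      have "(- d2 / s) ^ n * ((-1) ^ (N + n) * (s / of_real pi) ^ n) = (-1) ^ N * (d2 / of_real pi) ^ n" for N
        unfolding e power_add power_divide power_mult_distrib using s0 sgn by (simp add: divide_simps)
      thus ?thesis unfolding det_coeff_0[OF a] sc by (simp only: power_0 mult_1_left diff_zero mult.assoc[symmetric])
    qed
    finally show ?thesis by simp
  qed
  moreover have "(\<lambda>x. Toeplitz_Delta d1 d2 n x \<alpha>) \<sim>[F]
       (\<lambda>x. (-1) ^ (n * (n + 1) div 2 + j * (n - 1)) * (d2 / of_real pi) ^ n *
            (d1 / d2 * s + c) ^ j *
            (Barnes_G (of_nat n - of_nat j + 1) * Barnes_G (- \<alpha> / 2 + of_nat n - of_nat j + 1) *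
             Barnes_G (of_nat j + 1) * Barnes_G (of_nat j + \<alpha> / 2 + 1) /
             (Barnes_G (- \<alpha> / 2 + of_nat n - 2 * of_nat j + 1) *
              Barnes_G (\<alpha> / 2 - of_nat n + 2 * of_nat j + 1))) *
            (x / 2) powr ((\<alpha> - 2 * of_nat n + 2 * of_nat j) * of_nat j - of_nat n * \<alpha> / 2))"
    if j: "j \<in> {1..n - 1}" and "d2 \<noteq> 0" "d1 * s + d2 * c \<noteq> 0"
       "2 * real n - 4 * real j - 2 < Re \<alpha>" "Re \<alpha> < 2 * real n - 4 * real j + 2" for j
  proof -
    have jn: "j \<le> n" using j by auto
    have "(\<lambda>x. Toeplitz_Delta d1 d2 n x \<alpha>) \<sim>[F]
      (\<lambda>x. ((d1 * s + d2 * c) / s) ^ j * (- d2 / s) ^ (n - j) * det_coeff n j (\<alpha> / 2) *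
      (x / 2) powr ((\<alpha> - 2 * of_nat n + 2 * of_nat j) * of_nat j - of_nat n * \<alpha> / 2))"
      by (rule asymp) (use that jn in auto)
    also have "((d1 * s + d2 * c) / s) ^ j * (- d2 / s) ^ (n - j) * det_coeff n j (\<alpha> / 2) =
        (-1) ^ (n * (n + 1) div 2 + j * (n - 1)) * (d2 / of_real pi) ^ n * (d1 / d2 * s + c) ^ j *
            (Barnes_G (of_nat n - of_nat j + 1) * Barnes_G (- \<alpha> / 2 + of_nat n - of_nat j + 1) *
             Barnes_G (of_nat j + 1) * Barnes_G (of_nat j + \<alpha> / 2 + 1) /
             (Barnes_G (- \<alpha> / 2 + of_nat n - 2 * of_nat j + 1) *
              Barnes_G (\<alpha> / 2 - of_nat n + 2 * of_nat j + 1)))"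
    proof -
      define k where "k = n - j"
      have n: "n = j + k" using jn by (simp add: k_def)
      have j0: "j > 0" using j by auto
      define D where "D = d1 / d2 * s + c"
      have D: "d1 * s + d2 * c = d2 * D" using \<open>d2 \<noteq> 0\<close> by (simp add: D_def field_simps)
      have e: "- d2 / s = (-1) * d2 / s" by simp
      \<comment> \<open>Since \<open>j n = j (n - 1) + j\<close>, the exponents differ by
        \<open>k + n + j = 2 (j + k)\<close>, which is even.\<close>
      have sg: "(-1) ^ k * (-1) ^ (N + j * n + n) = ((-1) ^ (N + j * (n - 1)) :: complex)" for N
      proof -
        have eq: "k + (N + j * n + n) = N + j * (n - 1) + 2 * (j + k)" 
        proof -
          have *: "j * n = j * (n - 1) + j" using j0 jn by (simp add: diff_mult_distrib2)
          have "k + n + j = 2 * (j + k)" using n by simp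
          thus ?thesis unfolding * by simp
        qed
        show ?thesis
          unfolding power_add[symmetric] eq unfolding power_add[of _ _ "2 * (j + k)"] power_minus1_even mult_1_right ..
      qed
      have "(d2 * D / s) ^ j * (- d2 / s) ^ k * ((-1) ^ (N + j * n + n) * (s / of_real pi) ^ n) =
          ((-1) ^ k * (-1) ^ (N + j * n + n)) * (d2 / of_real pi) ^ n * D ^ j" for N
      proof -
        have "z ^ n = z ^ j * z ^ k" for z :: complex unfolding n by (rule power_add)
        note pn = this[of s] this[of d2] this[of "of_real pi"]
        show ?thesis
          unfolding e power_divide power_mult_distrib pn using s0 by (simp add: divide_simps)
      qed
      thus ?thesis
        unfolding det_coeff_def sc D_def[symmetric] D k_def[symmetric] sg minus_divide_left
        by (simp only: mult.assoc[symmetric])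
    qed
    finally show ?thesis .
  qed
  moreover have "(\<lambda>x. Toeplitz_Delta d1 d2 n x \<alpha>) \<sim>[F]
       (\<lambda>x. (-1) ^ (n * (n + 1) div 2) / of_real pi ^ n * (d1 * s + d2 * c) ^ n *
            (Barnes_G (of_nat n + 1) * Barnes_G (- \<alpha> / 2 + 1) / Barnes_G (- \<alpha> / 2 - of_nat n + 1)) *
            (x / 2) powr (of_nat n * \<alpha> / 2))"
    if "d1 * s + d2 * c \<noteq> 0" "Re \<alpha> < - 2 * real n + 2 \<or> d2 = 0"
  proof -
    have "(\<lambda>x. Toeplitz_Delta d1 d2 n x \<alpha>) \<sim>[F]
      (\<lambda>x. ((d1 * s + d2 * c) / s) ^ n * (- d2 / s) ^ (n - n) * det_coeff n n (\<alpha> / 2) *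
      (x / 2) powr ((\<alpha> - 2 * of_nat n + 2 * of_nat n) * of_nat n - of_nat n * \<alpha> / 2))"
      by (rule asymp) (use that in auto)
    also have "((d1 * s + d2 * c) / s) ^ n * (- d2 / s) ^ (n - n) * det_coeff n n (\<alpha> / 2) =
        (-1) ^ (n * (n + 1) div 2) / of_real pi ^ n * (d1 * s + d2 * c) ^ n *
            (Barnes_G (of_nat n + 1) * Barnes_G (- \<alpha> / 2 + 1) / Barnes_G (- \<alpha> / 2 - of_nat n + 1))"
      unfolding det_coeff_self[OF a] sc power_divide minus_divide_left using s0 by simp
    also have "(\<alpha> - 2 * of_nat n + 2 * of_nat n) * of_nat n - of_nat n * \<alpha> / 2 = of_nat n * \<alpha> / 2"
      by (simp add: field_simps)
    finally show ?thesis .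
  qed
  ultimately show ?thesis by blast
qed

end
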